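(* Let $\delta=a+b+c$. If one of the values $$-a,\ -b,\ -c,\ 1/2-g/2,\ a+g/2+1,\ b+g/2+1,\ c+g/2+1,$$ $$\delta+g+2,\ -(\delta+g/2+1),\quad a+b+g/2+3/2,$$ $$e_i-r\ (1\le i\le6),\ r$$ is an integer, then the equation $S\!E_5(a,b,c,g,p,q)$ is reducible.
   Context: Notation: $\partial=d/dx$, $\theta=x\partial$; $a,b,c,g,p,q$ are complex parameters. The operator $E_6(e_1,\dots,e_9)$: put $s=(6-e_1-\cdots-e_9)/3$ and $s_{11}=e_1+e_2+e_3$, $s_{12}=e_4+e_5+e_6$, $s_{13}=e_7+e_8+e_9$, $s_{21}=e_1e_2+e_1e_3+e_2e_3$, $s_{22}=e_4e_5+e_4e_6+e_5e_6$, $s_{23}=e_7e_8+e_7e_9+e_8e_9$, $s_{31}=e_1e_2e_3$, $s_{32}=e_4e_5e_6$, $s_{33}=e_7e_8e_9$. Then $E_6=T_0+T_1\partial+T_2\partial^2+T_3\partial^3$ with $T_0=(\theta+s+2)(\theta+s+1)(\theta+s)(\theta+e_7)(\theta+e_8)(\theta+e_9)$, $T_1=(\theta+s+2)(\theta+s+1)B_1$, $B_1=T_{13}\theta^3+T_{12}\theta^2+T_{11}\theta+T_{10}$, $T_2=(\theta+s+2)B_2$, $B_2=T_{23}\theta^3+T_{22}\theta^2+T_{21}\theta+T_{20}$, $T_3=-(\theta+3-e_1)(\theta+3-e_2)(\theta+3-e_3)$, where $T_{13}=-3$, $T_{23}=3$, $T_{12}=-9+s_{11}-2s_{13}$, $T_{22}=18+s_{13}-2s_{11}$,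 $T_{11}=-8+(s_{11}^2+2s_{11}s_{13}-s_{12}^2+s_{13}^2)/3+s_{11}-5s_{13}-s_{21}+s_{22}-2s_{23}$, $T_{21}=35+(-s_{11}^2-2s_{11}s_{13}+s_{12}^2-s_{13}^2)/3-7s_{11}+5s_{13}+2s_{21}-s_{22}+s_{23}$, $T_{20}=-T_{10}+19+(s_{11}^2s_{13}-s_{11}s_{12}^2+s_{11}s_{13}^2-s_{12}^2s_{13})/9+(s_{13}^3+s_{11}^3-2s_{12}^3)/27+(-2s_{11}^2-4s_{11}s_{13}+s_{11}s_{22}+2s_{12}^2+s_{22}s_{12}-2s_{13}^2+s_{22}s_{13})/3-5s_{11}+4s_{13}+3s_{21}-2s_{22}-s_{31}-s_{32}-s_{33}$, $2T_{10}=(2s_{11}+s_{11}^2+2s_{11}s_{13}-s_{12}^2+s_{13}^2-s_{11}s_{21}+2s_{11}s_{23}+s_{12}s_{22}-2s_{13}s_{21}+2s_{13}s_{22}+s_{13}s_{23}-14s_{13})/3+2(s_{11}^2s_{13}-s_{12}^2s_{13})/9+2(s_{11}^3-s_{12}^3)/27-5-s_{21}+s_{31}+s_{22}-s_{32}-5s_{23}-3s_{33}$. The operator $E_5(e_1,\dots,e_8)$ is the order 5 operator determined by $E_6(e_1,\dots,e_8,0)=E_5(e_1,\dots,e_8)\circ\partial$. Explicitly $E_5=x\overline T_0+\overline T_1+\overline T_2\partial+\overline T_3\partial^2$ with $\overline T_0=(\theta+s+1)(\theta+s+2)(\theta+s+3)(\theta+e_7+1)(\theta+e_8+1)$, $\overline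 T_1=(\theta+s+1)(\theta+s+2)B_1|_{e_9=0}$, $\overline T_2=(\theta+s+2)B_2|_{e_9=0}$, $\overline T_3=T_3$. The operator $S\!E_5(a,b,c,g,p,q)$ is $E_5(e_1,\dots,e_8)$ with $e_1=-2a-2b-2c-g-q-2$, $e_2=-a-c-2b-g-q-1$, $e_3=-2b-q$, $e_4=-2a-2b-2c-g-p-2$, $e_5=-b-c-2a-g-p-1$, $e_6=-2a-p$, $e_7=2a+2b+g+2$, $e_8=a+b+1$, and $r:=-2a-2b-2c-g-p-q-3=-s$. Thus $e_1-r=p+1$, $e_2-r=a+c+p+2$, $e_3-r=2a+2c+p+g+3$, $e_4-r=q+1$, $e_5-r=b+c+q+2$, $e_6-r=2b+2c+q+g+3$. An operator $E\in\mathbb C(x)[\partial]$ is reducible if $E=F_1\circ F_2$ with $F_1,F_2\in\mathbb C(x)[\partial]$ of positive order. *)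

theory Defs
  imports
    "HOL-Computational_Algebra.Computational_Algebra"
    "HOL-Computational_Algebra.Field_as_Ring"
begin

section \<open>The differential field of rational functions\<close>

type_synonym ratfun = "complex poly fract"

definition ratfun_deriv :: "ratfun \<Rightarrow> ratfun" where
  "ratfun_deriv f =
    (let (u, v) = quot_of_fract f in Fract (pderiv u * v - u * pderiv v) (v * v))"

lemma ratfun_deriv_Fract:
  assumes "v \<noteq> 0"
  shows "ratfun_deriv (Fract u v) = Fract (pderiv u * v - u * pderiv v) (v * v)"
proof -
  obtain u' v' where q: "quot_of_fract (Fract u v) = (u', v')"
    by (cases "quot_of_fract (Fract u v)")
  have v': "v' \<noteq> 0"
    using snd_quot_of_fract_nonzero[of "Fract u v"] by (simp add: q)
  have "Fract u' v' = Fract u v"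
    using quot_to_fract_quot_of_fract[of "Fract u v"] by (simp add: q quot_to_fract_def)
  with assms v' have eq: "u * v' = u' * v"
    by (simp add: eq_fract)
  have d: "pderiv u * v' + u * pderiv v' = pderiv u' * v + u' * pderiv v"
    using arg_cong[OF eq, of pderiv] by (simp add: pderiv_mult algebra_simps)
  have "(pderiv u' * v' - u' * pderiv v') * (v * v) - (pderiv u * v - u * pderiv v) * (v' * v')
    = v * v' * ((pderiv u' * v + u' * pderiv v) - (pderiv u * v' + u * pderiv v'))
      + (u * v' - u' * v) * (pderiv v * v' + pderiv v' * v)"
    by (simp add: algebra_simps)
  also have "\<dots> = 0" by (simp add: d eq)
  finally show ?thesis
    using assms v' by (simp add: ratfun_deriv_def q eq_fract)
qed

lemma ratfun_deriv_0 [simp]: "ratfun_deriv 0 = 0"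
  using ratfun_deriv_Fract[of 1 0] by (simp add: fract_collapse)

lemma ratfun_deriv_1 [simp]: "ratfun_deriv 1 = 0"
  using ratfun_deriv_Fract[of 1 1] by (simp add: fract_collapse)

lemma ratfun_deriv_add: "ratfun_deriv (f + h) = ratfun_deriv f + ratfun_deriv h"
proof -
  obtain a b where f: "f = Fract a b" "b \<noteq> 0" by (cases f)
  obtain c d where h: "h = Fract c d" "d \<noteq> 0" by (cases h)
  have "pderiv (a * d + c * b) * (b * d) - (a * d + c * b) * pderiv (b * d)
      = (pderiv a * b - a * pderiv b) * (d * d) + (pderiv c * d - c * pderiv d) * (b * b)"
    unfolding pderiv_add pderiv_mult by (simp only: algebra_simps)
  moreover have "(b * d) * (b * d) = (b * b) * (d * d)"
    by (simp only: ac_simps)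
  ultimately show ?thesis
    using f h by (simp only: ratfun_deriv_Fract add_fract mult_eq_0_iff simp_thms)
qed

lemma ratfun_deriv_mult: "ratfun_deriv (f * h) = ratfun_deriv f * h + f * ratfun_deriv h"
proof -
  obtain a b where f: "f = Fract a b" "b \<noteq> 0" by (cases f)
  obtain c d where h: "h = Fract c d" "d \<noteq> 0" by (cases h)
  let ?n = "pderiv (a * c) * (b * d) - (a * c) * pderiv (b * d)"
  let ?m = "((pderiv a * b - a * pderiv b) * c) * (b * (d * d))
    + (a * (pderiv c * d - c * pderiv d)) * ((b * b) * d)"
  have "?m = (b * d) * ?n"
    unfolding pderiv_mult by (simp only: algebra_simps)
  moreover have "((b * b) * d) * (b * (d * d)) = (b * d) * ((b * d) * (b * d))"
    by (simp only: ac_simps)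
  ultimately have "Fract ?m (((b * b) * d) * (b * (d * d))) = Fract ?n ((b * d) * (b * d))"
    using f h by (simp only: mult_fract_cancel mult_eq_0_iff simp_thms)
  then show ?thesis
    using f h by (simp only: ratfun_deriv_Fract mult_fract add_fract mult_eq_0_iff simp_thms)
qed

section \<open>The ring of linear differential operators with rational coefficients\<close>

text \<open>
  The operator \<open>\<Sum>i. A\<^sub>i \<partial>\<^sup>i\<close> in \<open>\<complex>(x)[\<partial>]\<close>, with coefficients written to the left of \<open>\<partial>\<close>, is
  represented by the polynomial with coefficients \<open>A\<^sub>i\<close>; the order is the degree of that polynomial.
\<close>

datatype diffop = Diffop (symbol: "ratfun poly")

lemma symbol_inject: "A = B \<longleftrightarrow> symbol A = symbol B"
  by (cases A; cases B) simp

definition diffop_order :: "diffop \<Rightarrow> nat" where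
  "diffop_order A = degree (symbol A)"

text \<open>Left multiplication by \<open>\<partial>\<close>: \<open>\<partial> \<circ> (f \<partial>\<^sup>j) = f \<partial>\<^sup>j\<^sup>+\<^sup>1 + f' \<partial>\<^sup>j\<close>.\<close>

definition D_symbol :: "ratfun poly \<Rightarrow> ratfun poly" where
  "D_symbol B = pCons 0 B + map_poly ratfun_deriv B"

definition mult_symbol :: "ratfun poly \<Rightarrow> ratfun poly \<Rightarrow> ratfun poly" where
  "mult_symbol A B = (\<Sum>i\<le>degree A. smult (coeff A i) ((D_symbol ^^ i) B))"

lemma D_symbol_0 [simp]: "D_symbol 0 = 0"
  by (simp add: D_symbol_def)

lemma coeff_D_symbol:
  "coeff (D_symbol B) n = (case n of 0 \<Rightarrow> 0 | Suc m \<Rightarrow> coeff B m) + ratfun_deriv (coeff B n)"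
  by (simp add: D_symbol_def coeff_map_poly coeff_pCons)

lemma D_symbol_add: "D_symbol (A + B) = D_symbol A + D_symbol B"
  by (rule poly_eqI) (simp add: coeff_D_symbol ratfun_deriv_add split: nat.split)

lemma D_symbol_smult: "D_symbol (smult f A) = smult f (D_symbol A) + smult (ratfun_deriv f) A"
  by (rule poly_eqI) (simp add: coeff_D_symbol ratfun_deriv_mult algebra_simps split: nat.split)

lemma D_symbol_sum: "D_symbol (\<Sum>i\<in>I. h i) = (\<Sum>i\<in>I. D_symbol (h i))"
  by (induction I rule: infinite_finite_induct) (simp_all add: D_symbol_add)

lemma D_symbol_pow_0 [simp]: "(D_symbol ^^ i) 0 = 0"
  by (induction i) simp_all

lemma D_symbol_pow_add: "(D_symbol ^^ i) (A + B) = (D_symbol ^^ i) A + (D_symbol ^^ i) B"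
  by (induction i) (simp_all add: D_symbol_add)

lemma D_symbol_pow_1: "(D_symbol ^^ i) 1 = monom 1 i"
proof (induction i)
  case (Suc i)
  show ?case
    by (rule poly_eqI) (simp add: Suc coeff_D_symbol split: nat.split)
qed simp

lemma mult_symbol_bound:
  assumes "degree A \<le> n"
  shows "mult_symbol A B = (\<Sum>i\<le>n. smult (coeff A i) ((D_symbol ^^ i) B))"
  unfolding mult_symbol_def using assms
  by (intro sum.mono_neutral_left) (auto simp: coeff_eq_0)

lemma mult_symbol_0_left [simp]: "mult_symbol 0 B = 0"
  by (simp add: mult_symbol_def)

lemma mult_symbol_1_left: "mult_symbol 1 B = B"
  by (simp add: mult_symbol_def)

lemma mult_symbol_1_right: "mult_symbol A 1 = A"
  by (simp add: mult_symbol_def D_symbol_pow_1 smult_monom poly_as_sum_of_monoms)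

lemma mult_symbol_add_left: "mult_symbol (A + B) C = mult_symbol A C + mult_symbol B C"
proof -
  let ?n = "max (degree A) (degree B)"
  have "degree (A + B) \<le> ?n" by (rule degree_add_le_max)
  then show ?thesis
    by (simp add: mult_symbol_bound[where n = ?n] smult_add_left sum.distrib)
qed

lemma mult_symbol_add_right: "mult_symbol A (B + C) = mult_symbol A B + mult_symbol A C"
  by (simp add: mult_symbol_def D_symbol_pow_add smult_add_right sum.distrib)

lemma mult_symbol_smult_left: "mult_symbol (smult f A) B = smult f (mult_symbol A B)"
proof -
  have sum_smult: "smult f (\<Sum>i\<in>I. h i) = (\<Sum>i\<in>I. smult f (h i))" for I :: "nat set" and h
    by (induction I rule: infinite_finite_induct) (simp_all add: smult_add_right)
  show ?thesis
    by (simp add: mult_symbol_bound[OF degree_smult_le] mult_symbol_def[of A] sum_smult)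
qed

lemma mult_symbol_pCons_0: "mult_symbol (pCons 0 A) B = mult_symbol A (D_symbol B)"
proof -
  have "mult_symbol (pCons 0 A) B
      = (\<Sum>i\<le>Suc (degree A). smult (coeff (pCons 0 A) i) ((D_symbol ^^ i) B))"
    by (intro mult_symbol_bound degree_pCons_le)
  also have "\<dots> = mult_symbol A (D_symbol B)"
    by (subst sum.atMost_Suc_shift) (simp add: mult_symbol_def funpow_swap1)
  finally show ?thesis .
qed

lemma D_symbol_mult: "D_symbol (mult_symbol A B) = mult_symbol (D_symbol A) B"
proof -
  have *: "degree (map_poly ratfun_deriv A) \<le> degree A"
    by (rule map_poly_degree_leq)
  have "D_symbol (mult_symbol A B) = (\<Sum>i\<le>degree A. smult (coeff A i) ((D_symbol ^^ i) (D_symbol B)))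
      + (\<Sum>i\<le>degree A. smult (ratfun_deriv (coeff A i)) ((D_symbol ^^ i) B))"
    by (simp add: mult_symbol_def D_symbol_sum D_symbol_smult sum.distrib funpow_swap1)
  also have "\<dots> = mult_symbol A (D_symbol B) + mult_symbol (map_poly ratfun_deriv A) B"
    by (simp add: mult_symbol_bound[OF *] mult_symbol_def[of A] coeff_map_poly)
  finally show ?thesis
    by (simp add: D_symbol_def[of A] mult_symbol_add_left mult_symbol_pCons_0)
qed

lemma D_symbol_pow_mult: "(D_symbol ^^ i) (mult_symbol A B) = mult_symbol ((D_symbol ^^ i) A) B"
  by (induction i) (simp_all add: D_symbol_mult)

lemma mult_symbol_sum_left: "mult_symbol (\<Sum>i\<in>I. h i) B = (\<Sum>i\<in>I. mult_symbol (h i) B)"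
  by (induction I rule: infinite_finite_induct) (simp_all add: mult_symbol_add_left)

lemma mult_symbol_assoc: "mult_symbol (mult_symbol A B) C = mult_symbol A (mult_symbol B C)"
  unfolding mult_symbol_def[of A]
  by (simp add: mult_symbol_sum_left mult_symbol_smult_left D_symbol_pow_mult)

instantiation diffop :: ring_1
begin

definition zero_diffop :: diffop where "0 = Diffop 0"
definition one_diffop :: diffop where "1 = Diffop 1"
definition plus_diffop :: "diffop \<Rightarrow> diffop \<Rightarrow> diffop" where
  "A + B = Diffop (symbol A + symbol B)"
definition uminus_diffop :: "diffop \<Rightarrow> diffop" where
  "- A = Diffop (- symbol A)"
definition minus_diffop :: "diffop \<Rightarrow> diffop \<Rightarrow> diffop" where
  "A - B = Diffop (symbol A - symbol B)"
text \<open>The product is composition of operators.\<close>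
definition times_diffop :: "diffop \<Rightarrow> diffop \<Rightarrow> diffop" where
  "A * B = Diffop (mult_symbol (symbol A) (symbol B))"

instance
  by standard
    (simp_all add: symbol_inject zero_diffop_def one_diffop_def plus_diffop_def uminus_diffop_def
      minus_diffop_def times_diffop_def mult_symbol_assoc mult_symbol_1_left mult_symbol_1_right
      mult_symbol_add_left mult_symbol_add_right)

end

definition mult_op :: "ratfun \<Rightarrow> diffop" where
  "mult_op f = Diffop [:f:]"

definition const_op :: "complex \<Rightarrow> diffop" where
  "const_op k = mult_op (to_fract [:k:])"

definition x_op :: diffop where
  "x_op = mult_op (to_fract [:0, 1:])"

definition D_op :: diffop (\<open>\<partial>\<close>) where
  "\<partial> = Diffop [:0, 1:]"

definition theta_op :: diffop (\<open>\<theta>\<close>) where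
  "\<theta> = x_op * \<partial>"

definition reducible_op :: "diffop \<Rightarrow> bool" where
  "reducible_op A \<longleftrightarrow>
    (\<exists>F\<^sub>1 F\<^sub>2. 0 < diffop_order F\<^sub>1 \<and> 0 < diffop_order F\<^sub>2 \<and> A = F\<^sub>1 * F\<^sub>2)"

lemma mult_op_mult: "mult_op f * mult_op h = mult_op (f * h)"
  by (simp add: mult_op_def times_diffop_def mult_symbol_def)

lemma mult_op_add: "mult_op f + mult_op h = mult_op (f + h)"
  by (simp add: mult_op_def plus_diffop_def)

lemma mult_op_1: "mult_op 1 = 1"
  by (simp add: mult_op_def one_diffop_def)

lemma mult_op_0: "mult_op 0 = 0"
  by (simp add: mult_op_def zero_diffop_def)

lemma D_op_mult_op: "\<partial> * mult_op f = mult_op f * \<partial> + mult_op (ratfun_deriv f)"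
  by (simp add: D_op_def mult_op_def times_diffop_def plus_diffop_def mult_symbol_def
      D_symbol_def map_poly_pCons)

lemma const_op_add: "const_op (k + l) = const_op k + const_op l"
  by (simp add: const_op_def mult_op_add flip: to_fract_add)

lemma const_op_1: "const_op 1 = 1"
  by (simp add: const_op_def mult_op_1 flip: one_pCons)

lemma const_op_0: "const_op 0 = 0"
  by (simp add: const_op_def mult_op_0)

lemma x_op_const_op: "x_op * const_op k = const_op k * x_op"
  by (simp add: x_op_def const_op_def mult_op_mult mult.commute)

lemma D_op_x_op: "\<partial> * x_op = x_op * \<partial> + 1"
  by (simp add: x_op_def D_op_mult_op to_fract_def ratfun_deriv_Fract pderiv_pCons mult_op_1
      flip: One_fract_def one_pCons)

lemma D_op_const_op: "\<partial> * const_op k = const_op k * \<partial>"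
  by (simp add: const_op_def D_op_mult_op to_fract_def ratfun_deriv_Fract pderiv_pCons mult_op_0
      fract_collapse)

lemma theta_x_op: "(\<theta> + const_op k) * x_op = x_op * (\<theta> + const_op (k + 1))"
  by (simp add: theta_op_def distrib_left distrib_right mult.assoc D_op_x_op x_op_const_op
      const_op_add const_op_1 ac_simps)

lemma theta_const_op: "\<theta> * const_op k = const_op k * \<theta>"
  by (metis theta_op_def mult.assoc D_op_const_op x_op_const_op)


section \<open>The operators \<open>E\<^sub>6\<close>, \<open>E\<^sub>5\<close> and \<open>SE\<^sub>5\<close>\<close>

text \<open>A parameter tuple \<open>(e\<^sub>1, \<dots>, e\<^sub>9)\<close> is a function on indices; only the values at
  \<open>1, \<dots>, 9\<close> matter.\<close>

definition s_par :: "(nat \<Rightarrow> complex) \<Rightarrow> complex" where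
  "s_par e = (6 - e 1 - e 2 - e 3 - e 4 - e 5 - e 6 - e 7 - e 8 - e 9) / 3"

definition s11 :: "(nat \<Rightarrow> complex) \<Rightarrow> complex" where "s11 e = e 1 + e 2 + e 3"
definition s12 :: "(nat \<Rightarrow> complex) \<Rightarrow> complex" where "s12 e = e 4 + e 5 + e 6"
definition s13 :: "(nat \<Rightarrow> complex) \<Rightarrow> complex" where "s13 e = e 7 + e 8 + e 9"
definition s21 :: "(nat \<Rightarrow> complex) \<Rightarrow> complex" where
  "s21 e = e 1 * e 2 + e 1 * e 3 + e 2 * e 3"
definition s22 :: "(nat \<Rightarrow> complex) \<Rightarrow> complex" where
  "s22 e = e 4 * e 5 + e 4 * e 6 + e 5 * e 6"
definition s23 :: "(nat \<Rightarrow> complex) \<Rightarrow> complex" where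
  "s23 e = e 7 * e 8 + e 7 * e 9 + e 8 * e 9"
definition s31 :: "(nat \<Rightarrow> complex) \<Rightarrow> complex" where "s31 e = e 1 * e 2 * e 3"
definition s32 :: "(nat \<Rightarrow> complex) \<Rightarrow> complex" where "s32 e = e 4 * e 5 * e 6"
definition s33 :: "(nat \<Rightarrow> complex) \<Rightarrow> complex" where "s33 e = e 7 * e 8 * e 9"

definition T13 :: complex where "T13 = -3"

definition T12 :: "(nat \<Rightarrow> complex) \<Rightarrow> complex" where
  "T12 e = -9 + s11 e - 2 * s13 e"

definition T11 :: "(nat \<Rightarrow> complex) \<Rightarrow> complex" where
  "T11 e = -8 + ((s11 e)^2 + 2 * s11 e * s13 e - (s12 e)^2 + (s13 e)^2) / 3
    + s11 e - 5 * s13 e - s21 e + s22 e - 2 * s23 e"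

definition T10 :: "(nat \<Rightarrow> complex) \<Rightarrow> complex" where
  "T10 e =
    ((2 * s11 e + (s11 e)^2 + 2 * s11 e * s13 e - (s12 e)^2 + (s13 e)^2 - s11 e * s21 e
       + 2 * s11 e * s23 e + s12 e * s22 e - 2 * s13 e * s21 e + 2 * s13 e * s22 e
       + s13 e * s23 e - 14 * s13 e) / 3
     + 2 * ((s11 e)^2 * s13 e - (s12 e)^2 * s13 e) / 9
     + 2 * ((s11 e)^3 - (s12 e)^3) / 27
     - 5 - s21 e + s31 e + s22 e - s32 e - 5 * s23 e - 3 * s33 e) / 2"

definition T23 :: complex where "T23 = 3"

definition T22 :: "(nat \<Rightarrow> complex) \<Rightarrow> complex" where
  "T22 e = 18 + s13 e - 2 * s11 e"

definition T21 :: "(nat \<Rightarrow> complex) \<Rightarrow> complex" where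
  "T21 e = 35 + (- ((s11 e)^2) - 2 * s11 e * s13 e + (s12 e)^2 - (s13 e)^2) / 3
    - 7 * s11 e + 5 * s13 e + 2 * s21 e - s22 e + s23 e"

definition T20 :: "(nat \<Rightarrow> complex) \<Rightarrow> complex" where
  "T20 e = - T10 e + 19
    + ((s11 e)^2 * s13 e - s11 e * (s12 e)^2 + s11 e * (s13 e)^2 - (s12 e)^2 * s13 e) / 9
    + ((s13 e)^3 + (s11 e)^3 - 2 * (s12 e)^3) / 27
    + (- 2 * (s11 e)^2 - 4 * s11 e * s13 e + s11 e * s22 e + 2 * (s12 e)^2 + s22 e * s12 e
       - 2 * (s13 e)^2 + s22 e * s13 e) / 3
    - 5 * s11 e + 4 * s13 e + 3 * s21 e - 2 * s22 e - s31 e - s32 e - s33 e"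

definition B1 :: "(nat \<Rightarrow> complex) \<Rightarrow> diffop" where
  "B1 e = const_op T13 * \<theta>^3 + const_op (T12 e) * \<theta>^2 + const_op (T11 e) * \<theta> + const_op (T10 e)"

definition B2 :: "(nat \<Rightarrow> complex) \<Rightarrow> diffop" where
  "B2 e = const_op T23 * \<theta>^3 + const_op (T22 e) * \<theta>^2 + const_op (T21 e) * \<theta> + const_op (T20 e)"

definition T0 :: "(nat \<Rightarrow> complex) \<Rightarrow> diffop" where
  "T0 e = (\<theta> + const_op (s_par e + 2)) * (\<theta> + const_op (s_par e + 1)) * (\<theta> + const_op (s_par e))
    * (\<theta> + const_op (e 7)) * (\<theta> + const_op (e 8)) * (\<theta> + const_op (e 9))"

definition T1 :: "(nat \<Rightarrow> complex) \<Rightarrow> diffop" where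
  "T1 e = (\<theta> + const_op (s_par e + 2)) * (\<theta> + const_op (s_par e + 1)) * B1 e"

definition T2 :: "(nat \<Rightarrow> complex) \<Rightarrow> diffop" where
  "T2 e = (\<theta> + const_op (s_par e + 2)) * B2 e"

definition T3 :: "(nat \<Rightarrow> complex) \<Rightarrow> diffop" where
  "T3 e = - ((\<theta> + const_op (3 - e 1)) * (\<theta> + const_op (3 - e 2)) * (\<theta> + const_op (3 - e 3)))"

definition E6 :: "(nat \<Rightarrow> complex) \<Rightarrow> diffop" where
  "E6 e = T0 e + T1 e * \<partial> + T2 e * \<partial>^2 + T3 e * \<partial>^3"

text \<open>\<open>E\<^sub>5\<close> takes \<open>(e\<^sub>1, \<dots>, e\<^sub>8)\<close>: the ninth parameter is overwritten by \<open>0\<close>, also in \<open>s\<close>.\<close>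

definition T0_bar :: "(nat \<Rightarrow> complex) \<Rightarrow> diffop" where
  "T0_bar e = (\<theta> + const_op (s_par e + 1)) * (\<theta> + const_op (s_par e + 2)) * (\<theta> + const_op (s_par e + 3))
    * (\<theta> + const_op (e 7 + 1)) * (\<theta> + const_op (e 8 + 1))"

definition T1_bar :: "(nat \<Rightarrow> complex) \<Rightarrow> diffop" where
  "T1_bar e = (\<theta> + const_op (s_par e + 1)) * (\<theta> + const_op (s_par e + 2)) * B1 e"

definition E5 :: "(nat \<Rightarrow> complex) \<Rightarrow> diffop" where
  "E5 e = (let e' = e(9 := 0) in
     x_op * T0_bar e' + T1_bar e' + T2 e' * \<partial> + T3 e' * \<partial>^2)"

lemma theta_plus_commute: "(\<theta> + const_op k) * (\<theta> + const_op l) = (\<theta> + const_op l) * (\<theta> + const_op k)"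
proof -
  have "const_op k * const_op l = const_op l * const_op k"
    by (simp add: const_op_def mult_op_mult mult.commute)
  then show ?thesis
    by (simp add: distrib_left distrib_right theta_const_op ac_simps)
qed

lemma E6_eq_E5_D_op: "E6 (e(9 := 0)) = E5 e * \<partial>"
proof -
  define e' where "e' = e(9 := 0)"
  have 9: "e' 9 = 0" by (simp add: e'_def)
  let ?s = "s_par e'"
  have x: "(\<theta> + const_op k) * (x_op * Z) = x_op * ((\<theta> + const_op (k + 1)) * Z)" for k Z
    using theta_x_op[of k] by (metis mult.assoc)
  have "T0 e' = (\<theta> + const_op (?s + 2)) * ((\<theta> + const_op (?s + 1)) * ((\<theta> + const_op (?s))
      * ((\<theta> + const_op (e' 7)) * ((\<theta> + const_op (e' 8)) * (x_op * \<partial>)))))"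
    by (simp add: T0_def 9 const_op_0 theta_op_def mult.assoc)
  also have "\<dots> = x_op * ((\<theta> + const_op (?s + 3)) * ((\<theta> + const_op (?s + 2)) * (\<theta> + const_op (?s + 1)))
      * (\<theta> + const_op (e' 7 + 1)) * (\<theta> + const_op (e' 8 + 1))) * \<partial>"
    by (simp add: x mult.assoc add.assoc)
  also have "(\<theta> + const_op (?s + 3)) * ((\<theta> + const_op (?s + 2)) * (\<theta> + const_op (?s + 1)))
      = (\<theta> + const_op (?s + 1)) * (\<theta> + const_op (?s + 2)) * (\<theta> + const_op (?s + 3))"
    by (simp only: theta_plus_commute[of "?s + 2" "?s + 1"] theta_plus_commute[of "?s + 3" "?s + 1"]
        theta_plus_commute[of "?s + 3" "?s + 2"] mult.assoc
        flip: mult.assoc[of "\<theta> + const_op (?s + 3)"])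
  finally have T0: "T0 e' = x_op * T0_bar e' * \<partial>"
    by (simp only: T0_bar_def)
  have T1: "T1 e' = T1_bar e'"
    unfolding T1_def T1_bar_def theta_plus_commute[of "?s + 2" "?s + 1"] ..
  have "E6 e' = (x_op * T0_bar e' + T1_bar e' + T2 e' * \<partial> + T3 e' * \<partial>^2) * \<partial>"
    unfolding E6_def T0 T1 by (simp only: distrib_right mult.assoc power2_eq_square power3_eq_cube)
  then show ?thesis
    by (simp only: E5_def Let_def e'_def)
qed

definition SE5_exps ::
  "complex \<Rightarrow> complex \<Rightarrow> complex \<Rightarrow> complex \<Rightarrow> complex \<Rightarrow> complex \<Rightarrow> nat \<Rightarrow> complex" where
  "SE5_exps a b c g p q = (\<lambda>_. 0)(
     1 := -2*a - 2*b - 2*c - g - q - 2,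
     2 := -a - c - 2*b - g - q - 1,
     3 := -2*b - q,
     4 := -2*a - 2*b - 2*c - g - p - 2,
     5 := -b - c - 2*a - g - p - 1,
     6 := -2*a - p,
     7 := 2*a + 2*b + g + 2,
     8 := a + b + 1)"

definition SE5_r ::
  "complex \<Rightarrow> complex \<Rightarrow> complex \<Rightarrow> complex \<Rightarrow> complex \<Rightarrow> complex \<Rightarrow> complex" where
  "SE5_r a b c g p q = -2*a - 2*b - 2*c - g - p - q - 3"

definition SE5 ::
  "complex \<Rightarrow> complex \<Rightarrow> complex \<Rightarrow> complex \<Rightarrow> complex \<Rightarrow> complex \<Rightarrow> diffop" where
  "SE5 a b c g p q = E5 (SE5_exps a b c g p q)"

lemma SE5_r_eq: "SE5_r a b c g p q = - s_par ((SE5_exps a b c g p q)(9 := 0))"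
  by (simp add: s_par_def SE5_exps_def SE5_r_def minus_divide_left eq_divide_eq)

lemma SE5_exps_minus_r:
  "SE5_exps a b c g p q 1 - SE5_r a b c g p q = p + 1"
  "SE5_exps a b c g p q 2 - SE5_r a b c g p q = a + c + p + 2"
  "SE5_exps a b c g p q 3 - SE5_r a b c g p q = 2*a + 2*c + p + g + 3"
  "SE5_exps a b c g p q 4 - SE5_r a b c g p q = q + 1"
  "SE5_exps a b c g p q 5 - SE5_r a b c g p q = b + c + q + 2"
  "SE5_exps a b c g p q 6 - SE5_r a b c g p q = 2*b + 2*c + q + g + 3"
  by (simp_all add: SE5_exps_def SE5_r_def)

end

theory Submission
  imports Defs
begin

text \<open>
  If \<open>A \<circ> H = K \<circ> B\<close> with \<open>A\<close>, \<open>B\<close> of the same order and \<open>H \<noteq> 0\<close> of smaller order, then \<open>A\<close> is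
  reducible iff \<open>B\<close> is, because \<open>H\<close> induces a nonzero map between left modules of equal dimension.
  Such intertwining operators exist between \<open>SE\<^sub>5\<close> and its translates under
  \<open>p \<mapsto> p + 1\<close>, \<open>q \<mapsto> q + 1\<close>, \<open>a \<mapsto> a + 1\<close> and \<open>(c, g, p, q) \<mapsto> (c - 1, g + 2, p + 1, q + 1)\<close>, while
  \<open>SE\<^sub>5\<close> is invariant under \<open>a \<leftrightarrow> b\<close>, \<open>c \<leftrightarrow> -(a + b + c + g + 2)\<close> with a change of \<open>p\<close>, \<open>q\<close>.
  Hence each integrality condition need only be treated for a single integer value, and for a
  suitable one an explicit right factor of order at most two splits off.
\<close>

section \<open>Euclidean division of differential operators\<close>

lemma diffop_order_0 [simp]: "diffop_order 0 = 0"
  by (simp add: diffop_order_def zero_diffop_def)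

lemma diffop_order_1 [simp]: "diffop_order 1 = 0"
  by (simp add: diffop_order_def one_diffop_def)

lemma diffop_one_neq_zero [simp]: "(1 :: diffop) \<noteq> 0"
  by (simp add: one_diffop_def zero_diffop_def)

lemma symbol_eq_0_iff: "symbol A = 0 \<longleftrightarrow> A = 0"
  by (simp add: symbol_inject zero_diffop_def)

lemma degree_lead_D_symbol:
  assumes "B \<noteq> 0"
  shows "degree (D_symbol B) = Suc (degree B)" "lead_coeff (D_symbol B) = lead_coeff B"
proof -
  have top: "coeff (D_symbol B) (Suc (degree B)) = lead_coeff B"
    by (simp add: coeff_D_symbol coeff_eq_0)
  have "degree (D_symbol B) \<le> Suc (degree B)"
    by (rule degree_le) (auto simp: coeff_D_symbol coeff_eq_0 split: nat.split)
  moreover have "Suc (degree B) \<le> degree (D_symbol B)"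
    using assms top by (intro le_degree) simp
  ultimately show "degree (D_symbol B) = Suc (degree B)" by simp
  with top show "lead_coeff (D_symbol B) = lead_coeff B" by simp
qed

lemma degree_lead_D_symbol_pow:
  assumes "B \<noteq> 0"
  shows "degree ((D_symbol ^^ i) B) = degree B + i \<and> lead_coeff ((D_symbol ^^ i) B) = lead_coeff B"
proof (induction i)
  case (Suc i)
  with assms have "(D_symbol ^^ i) B \<noteq> 0"
    by (metis leading_coeff_0_iff)
  then show ?case
    using Suc degree_lead_D_symbol[of "(D_symbol ^^ i) B"]
    by (metis add_Suc_right funpow.simps(2) o_apply)
qed simp

text \<open>Only the summand with \<open>i = degree A\<close> reaches degree
  \<open>degree A + degree B\<close>, and \<open>D_symbol\<close> keeps leading coefficients. So
  orders add and leading coefficients multiply, although the ring is not commutative.\<close>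

lemma degree_mult_symbol:
  assumes "A \<noteq> 0" "B \<noteq> 0"
  shows "degree (mult_symbol A B) = degree A + degree B"
    and "coeff (mult_symbol A B) (degree A + degree B) = lead_coeff A * lead_coeff B"
proof -
  have le: "degree ((D_symbol ^^ i) B) \<le> i + degree B" for i
    using degree_lead_D_symbol_pow[OF assms(2)] by simp
  have zero: "coeff ((D_symbol ^^ i) B) n = 0" if "i + degree B < n" for i n
    using le[of i] that by (intro coeff_eq_0) linarith
  have "coeff (mult_symbol A B) (degree A + degree B)
      = (\<Sum>i\<le>degree A. coeff A i * coeff ((D_symbol ^^ i) B) (degree A + degree B))"
    by (simp add: mult_symbol_def coeff_sum)
  also have "\<dots> = (\<Sum>i\<in>{degree A}. coeff A i * coeff ((D_symbol ^^ i) B) (degree A + degree B))"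
    by (rule sum.mono_neutral_right) (auto simp: zero)
  also have "\<dots> = lead_coeff A * lead_coeff B"
    using degree_lead_D_symbol_pow[OF assms(2), of "degree A"]
    by (metis (no_types, lifting) add.commute sum.insert sum.empty finite.emptyI empty_iff add_0_right)
  finally show top: "coeff (mult_symbol A B) (degree A + degree B) = lead_coeff A * lead_coeff B" .
  have "degree (mult_symbol A B) \<le> degree A + degree B"
    by (rule degree_le) (auto simp: mult_symbol_def coeff_sum zero intro!: sum.neutral)
  moreover have "degree A + degree B \<le> degree (mult_symbol A B)"
    using assms top by (intro le_degree) simp
  ultimately show "degree (mult_symbol A B) = degree A + degree B" by simp
qed

lemma diffop_mult_nonzero:
  assumes "(A :: diffop) \<noteq> 0" "B \<noteq> 0"
  shows "A * B \<noteq> 0"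
proof -
  have "coeff (mult_symbol (symbol A) (symbol B)) (degree (symbol A) + degree (symbol B)) \<noteq> 0"
    using assms by (simp add: degree_mult_symbol symbol_eq_0_iff)
  then show ?thesis
    by (auto simp: times_diffop_def symbol_inject zero_diffop_def)
qed

lemma diffop_mult_eq_0_iff [simp]: "(A :: diffop) * B = 0 \<longleftrightarrow> A = 0 \<or> B = 0"
  using diffop_mult_nonzero by auto

lemma diffop_order_mult:
  "A \<noteq> 0 \<Longrightarrow> B \<noteq> 0 \<Longrightarrow> diffop_order (A * B) = diffop_order A + diffop_order B"
  by (simp add: diffop_order_def times_diffop_def degree_mult_symbol symbol_eq_0_iff)

lemma diffop_mult_right_cancel: "C \<noteq> 0 \<Longrightarrow> A * C = B * C \<longleftrightarrow> A = (B :: diffop)"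
  by (metis diffop_mult_eq_0_iff eq_iff_diff_eq_0 left_diff_distrib)

lemma diffop_right_division:
  assumes "B \<noteq> 0"
  shows "\<exists>Q R. A = Q * B + R \<and> (R = 0 \<or> diffop_order R < diffop_order B)"
proof (induction "diffop_order A" arbitrary: A rule: less_induct)
  case less
  show ?case
  proof (cases "A = 0 \<or> diffop_order A < diffop_order B")
    case True
    then show ?thesis by (intro exI[of _ 0] exI[of _ A]) auto
  next
    case False
    then have A: "A \<noteq> 0" and le: "diffop_order B \<le> diffop_order A" by auto
    define n where "n = diffop_order A - diffop_order B"
    define f where "f = lead_coeff (symbol A) / lead_coeff (symbol B)"
    \<comment> \<open>With this choice \<open>Q * B\<close> has the order and the leading
      coefficient of \<open>A\<close>, so subtracting it kills the top term.\<close>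
    define Q where "Q = Diffop (monom f n)"
    have B: "lead_coeff (symbol B) \<noteq> 0" and A': "lead_coeff (symbol A) \<noteq> 0"
      using assms A by (simp_all add: symbol_eq_0_iff)
    have f: "f \<noteq> 0" using A' B by (simp add: f_def)
    have Q: "Q \<noteq> 0" "degree (symbol Q) = n" "lead_coeff (symbol Q) = f"
      using f by (simp_all add: Q_def symbol_inject zero_diffop_def degree_monom_eq)
    have QB: "degree (symbol (Q * B)) = degree (symbol A)"
      using diffop_order_mult[OF Q(1) assms] Q(2) le by (simp add: diffop_order_def n_def)
    have "lead_coeff (symbol (Q * B)) = lead_coeff (symbol A)"
      using degree_mult_symbol[of "symbol Q" "symbol B"] Q assms B
      by (simp add: times_diffop_def symbol_eq_0_iff f_def)
    then have lead: "coeff (symbol (A - Q * B)) (degree (symbol A)) = 0"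
      using QB by (simp add: minus_diffop_def)
    have deg: "degree (symbol (A - Q * B)) \<le> degree (symbol A)"
      using QB by (simp add: minus_diffop_def degree_diff_le)
    show ?thesis
    proof (cases "A - Q * B = 0 \<or> diffop_order (A - Q * B) < diffop_order B")
      case True
      then show ?thesis by (intro exI[of _ Q] exI[of _ "A - Q * B"]) auto
    next
      case False
      then have "symbol (A - Q * B) \<noteq> 0" by (simp add: symbol_eq_0_iff)
      then have "degree (symbol (A - Q * B)) \<noteq> degree (symbol A)"
        using lead by (metis leading_coeff_0_iff)
      with deg have "diffop_order (A - Q * B) < diffop_order A"
        by (simp add: diffop_order_def)
      from less[OF this] obtain Q' R where
        "A - Q * B = Q' * B + R" "R = 0 \<or> diffop_order R < diffop_order B" by blast
      then show ?thesis
        by (intro exI[of _ "Q + Q'"] exI[of _ R]) (auto simp: algebra_simps)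
    qed
  qed
qed

lemma diffop_order_0_left_inverse:
  assumes "U \<noteq> 0" "diffop_order U = 0"
  shows "\<exists>V. V * U = 1"
proof -
  from assms obtain f where U: "U = mult_op f"
    by (metis degree_eq_zeroE diffop_order_def diffop.collapse mult_op_def)
  with assms have "f \<noteq> 0" by (auto simp: mult_op_0)
  then have "mult_op (inverse f) * U = 1"
    by (simp add: U mult_op_mult mult_op_1)
  then show ?thesis ..
qed

section \<open>Intertwining operators\<close>

text \<open>Euclid's algorithm, with the two operators exchanging roles: if
  \<open>H = Q * B + R\<close>, a relation \<open>K * B = G * R\<close> lifts to
  \<open>G * H = (G * Q + K) * B\<close>. Comparing orders in \<open>K * B = G * R\<close> carries
  the bound along.\<close>

lemma exists_common_left_multiple:
  assumes "B \<noteq> 0"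
  shows "\<exists>G K. G \<noteq> 0 \<and> G * H = K * B \<and> diffop_order G \<le> diffop_order B"
  using assms
proof (induction "diffop_order B" arbitrary: B H rule: less_induct)
  case less
  obtain Q R where R: "H = Q * B + R" "R = 0 \<or> diffop_order R < diffop_order B"
    using diffop_right_division[OF less.prems] by blast
  show ?case
  proof (cases "R = 0")
    case True
    then show ?thesis
      using R diffop_order_1 by (intro exI[of _ 1] exI[of _ Q]) simp
  next
    case False
    with R have lt: "diffop_order R < diffop_order B" by simp
    obtain K G where KG: "K \<noteq> 0" "K * B = G * R" "diffop_order K \<le> diffop_order R"
      using less.hyps[OF lt False] by blast
    have G: "G \<noteq> 0" using KG less.prems by (metis diffop_mult_eq_0_iff)
    have "diffop_order K + diffop_order B = diffop_order G + diffop_order R"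
      using KG G False less.prems by (metis diffop_order_mult)
    then have "diffop_order G \<le> diffop_order B" using KG(3) by linarith
    moreover have "G * H = (G * Q + K) * B"
      by (simp add: R(1) KG(2) distrib_left distrib_right mult.assoc)
    ultimately show ?thesis using G by blast
  qed
qed

definition right_coprime :: "diffop \<Rightarrow> diffop \<Rightarrow> bool" where
  "right_coprime H B \<longleftrightarrow> (\<forall>F X Y. H = X * F \<longrightarrow> B = Y * F \<longrightarrow> diffop_order F = 0)"

text \<open>For a trivial greatest common right divisor, the least common left multiple has order
  \<open>diffop_order H + diffop_order B\<close>; the claim is the resulting bound on the cofactor
  of \<open>H\<close>. The Euclidean step from \<open>(H, B)\<close> to \<open>(B, R)\<close>
  preserves coprimality.\<close>

lemma right_coprime_order:
  assumes "right_coprime H B" "H \<noteq> 0" "B \<noteq> 0" "G \<noteq> 0" "G * H = K * B"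
  shows "diffop_order B \<le> diffop_order G"
  using assms
proof (induction "diffop_order B" arbitrary: B H G K rule: less_induct)
  case less
  obtain Q R where R: "H = Q * B + R" "R = 0 \<or> diffop_order R < diffop_order B"
    using diffop_right_division[OF less.prems(3)] by blast
  show ?case
  proof (cases "R = 0")
    case True
    then have "H = Q * B" "B = 1 * B" using R by simp_all
    then have "diffop_order B = 0"
      using less.prems(1) unfolding right_coprime_def by blast
    then show ?thesis by simp
  next
    case False
    with R have lt: "diffop_order R < diffop_order B" by simp
    have eq: "(K - G * Q) * B = G * R"
      using less.prems(5) by (simp add: R(1) algebra_simps)
    then have nz: "K - G * Q \<noteq> 0"
      using False less.prems(4) by (metis diffop_mult_eq_0_iff)
    have "right_coprime B R"
      unfolding right_coprime_def
    proof (intro allI impI)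
      fix F X Y assume "B = X * F" "R = Y * F"
      then have "H = (Q * X + Y) * F" by (simp add: R(1) distrib_right mult.assoc)
      with \<open>B = X * F\<close> show "diffop_order F = 0"
        using less.prems(1) unfolding right_coprime_def by blast
    qed
    then have "diffop_order R \<le> diffop_order (K - G * Q)"
      by (rule less.hyps[OF lt _ less.prems(3) False nz eq])
    moreover have "diffop_order (K - G * Q) + diffop_order B = diffop_order G + diffop_order R"
      using eq nz False less.prems by (metis diffop_order_mult)
    ultimately show ?thesis by linarith
  qed
qed

text \<open>A common right factor of positive order leaves \<open>B\<close> a left cofactor of order
  0, so it has the order of \<open>B\<close> and is too large to divide \<open>H\<close>.\<close>

lemma right_coprime_if_irreducible:
  assumes "\<not> reducible_op B" "B \<noteq> 0" "H \<noteq> 0" "diffop_order H < diffop_order B"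
  shows "right_coprime H B"
  unfolding right_coprime_def
proof (intro allI impI)
  fix F X Y assume F: "H = X * F" "B = Y * F"
  then have nz: "X \<noteq> 0" "Y \<noteq> 0" "F \<noteq> 0" using assms by auto
  have "diffop_order Y = 0 \<or> diffop_order F = 0"
    using assms(1) F unfolding reducible_op_def by (metis neq0_conv)
  moreover have "diffop_order Y \<noteq> 0"
    using assms(4) F nz by (simp add: diffop_order_mult)
  ultimately show "diffop_order F = 0" by simp
qed

text \<open>Right multiplication by \<open>H\<close> maps the left module defined by
  \<open>A\<close> to the one defined by \<open>B\<close>. The operators \<open>G\<close> with
  \<open>G * H\<close> a left multiple of \<open>B\<close> form a left ideal containing
  \<open>A\<close>; its generator divides \<open>A\<close> on the right. It has positive order
  because the map is nonzero (\<open>ndvd\<close>), and its order is at most that of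
  \<open>B\<close>.\<close>

lemma reducible_if_intertwines_smaller:
  assumes "A * H = K * B" "A \<noteq> 0" "B \<noteq> 0" "diffop_order B < diffop_order A"
    and ndvd: "\<nexists>X. H = X * B"
  shows "reducible_op A"
proof -
  define P where "P = (\<lambda>G. G \<noteq> 0 \<and> (\<exists>X. G * H = X * B))"
  obtain G0 where G0: "P G0" "diffop_order G0 \<le> diffop_order B"
    using exists_common_left_multiple[OF assms(3), of H] by (auto simp: P_def)
  define G where "G = arg_min diffop_order P"
  have G: "P G" "\<And>G'. P G' \<Longrightarrow> diffop_order G \<le> diffop_order G'"
    using arg_min_nat_lemma[of P G0 diffop_order] G0 by (auto simp: G_def)
  from G(1) obtain X where X: "G \<noteq> 0" "G * H = X * B" by (auto simp: P_def)
  obtain Q R where R: "A = Q * G + R" "R = 0 \<or> diffop_order R < diffop_order G"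
    using diffop_right_division[OF X(1)] by blast
  have "R * H = (K - Q * X) * B"
    using assms(1) X(2) by (simp add: R(1) algebra_simps)
  then have "R = 0"
    using G(2)[of R] R(2) unfolding P_def by (meson leD)
  then have A: "A = Q * G" using R(1) by simp
  with assms(2) have "Q \<noteq> 0" by auto
  have "diffop_order G \<noteq> 0"
  proof
    assume "diffop_order G = 0"
    then obtain V where "V * G = 1" using diffop_order_0_left_inverse X(1) by blast
    then have "H = (V * X) * B" by (metis X(2) mult.assoc mult_1_left)
    with ndvd show False by blast
  qed
  moreover have "diffop_order G \<le> diffop_order B"
    using G(2)[OF G0(1)] G0(2) by linarith
  ultimately show ?thesis
    using A assms(4) diffop_order_mult[OF \<open>Q \<noteq> 0\<close> X(1)]
    unfolding reducible_op_def by (intro exI[of _ Q] exI[of _ G]) auto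
qed

lemma reducible_op_intertwine:
  assumes eq: "A * H = K * B" and ord: "diffop_order A = diffop_order B"
    and H: "H \<noteq> 0" "diffop_order H < diffop_order B"
  shows "reducible_op A \<longleftrightarrow> reducible_op B"
proof
  have A: "A \<noteq> 0" and B: "B \<noteq> 0" using H(2) ord by auto
  show "reducible_op B" if "reducible_op A"
  proof (rule ccontr)
    assume irred: "\<not> reducible_op B"
    from that obtain F1 F2 where F: "0 < diffop_order F1" "0 < diffop_order F2" "A = F1 * F2"
      by (auto simp: reducible_op_def)
    then have nz: "F1 \<noteq> 0" "F2 \<noteq> 0" by auto
    have sum: "diffop_order F1 + diffop_order F2 = diffop_order B"
      using F(3) nz ord diffop_order_mult by auto
    \<comment> \<open>No operator of order below that of the irreducible \<open>B\<close> can send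
      such an \<open>H'\<close> into the left multiples of \<open>B\<close>. Both outcomes of
      dividing \<open>F2 * H\<close> by \<open>B\<close> violate this: \<open>F2\<close> does so to
      \<open>H\<close>, or \<open>F1\<close> to the remainder.\<close>
    have cop: "diffop_order B \<le> diffop_order G"
      if "H' \<noteq> 0" "diffop_order H' < diffop_order B" "G \<noteq> 0" "G * H' = L * B" for H' G L
      using right_coprime_order[OF right_coprime_if_irreducible[OF irred B that(1,2)] that(1) B that(3,4)] .
    obtain Q R where R: "F2 * H = Q * B + R" "R = 0 \<or> diffop_order R < diffop_order B"
      using diffop_right_division[OF B] by blast
    show False
    proof (cases "R = 0")
      case True
      then show False using cop[OF H nz(2), of Q] R(1) F(1) sum by simp
    next
      case False
      have "F1 * R = (K - F1 * Q) * B"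
        using eq R(1) F(3) by (simp add: algebra_simps)
      then show False using cop[OF False _ nz(1)] R(2) False F(2) sum by fastforce
    qed
  qed
  show "reducible_op A" if "reducible_op B"
  proof -
    from that obtain F1 F2 where F: "0 < diffop_order F1" "0 < diffop_order F2" "B = F1 * F2"
      by (auto simp: reducible_op_def)
    then have nz: "F1 \<noteq> 0" "F2 \<noteq> 0" by auto
    have sum: "diffop_order F1 + diffop_order F2 = diffop_order A"
      using F(3) nz ord diffop_order_mult by auto
    \<comment> \<open>Either \<open>H\<close> is nonzero modulo \<open>F2\<close>, and
      \<open>H\<close> intertwines \<open>A\<close> with \<open>F2\<close>; or
      \<open>H = X * F2\<close>, and cancelling \<open>F2\<close> shows that \<open>X\<close>
      intertwines \<open>A\<close> with \<open>F1\<close>. Both targets have smaller order than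
      \<open>A\<close>.\<close>
    show ?thesis
    proof (cases "\<exists>X. H = X * F2")
      case False
      then show ?thesis
        using reducible_if_intertwines_smaller[of A H "K * F1" F2] eq A nz F sum
        by (simp add: mult.assoc)
    next
      case True
      then obtain X where X: "H = X * F2" by blast
      have "(A * X) * F2 = (K * F1) * F2" using eq X F(3) by (simp add: mult.assoc)
      then have AX: "A * X = K * F1" using diffop_mult_right_cancel nz(2) by blast
      have "\<nexists>Y. X = Y * F1"
      proof
        assume "\<exists>Y. X = Y * F1"
        then obtain Y where "X = Y * F1" by blast
        then have "H = Y * B" using X F(3) by (simp add: mult.assoc)
        then show False using H B by (auto simp: diffop_order_mult)
      qed
      then show ?thesis
        using reducible_if_intertwines_smaller[OF AX A nz(1)] F sum by simp
    qed
  qed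
qed

section \<open>Operators graded by powers of \<open>x\<close> and \<open>\<partial>\<close>\<close>

definition theta_poly :: "complex poly \<Rightarrow> diffop" where
  "theta_poly f = fold_coeffs (\<lambda>k A. const_op k + \<theta> * A) f 0"

lemma theta_poly_0 [simp]: "theta_poly 0 = 0"
  by (simp add: theta_poly_def)

lemma theta_poly_pCons [simp]: "theta_poly (pCons k f) = const_op k + \<theta> * theta_poly f"
  by (cases "f = 0 \<and> k = 0") (auto simp: theta_poly_def const_op_0)

lemma theta_poly_1 [simp]: "theta_poly 1 = 1"
  by (simp add: one_pCons const_op_1)

lemma const_op_mult: "const_op (k * l) = const_op k * const_op l"
  by (simp add: const_op_def mult_op_mult mult.commute flip: to_fract_mult)

lemma theta_poly_add: "theta_poly (f + h) = theta_poly f + theta_poly h"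
proof (induction f arbitrary: h)
  case (pCons k f)
  obtain l h' where "h = pCons l h'" by (cases h)
  then show ?case by (simp add: pCons.IH const_op_add distrib_left add_ac)
qed simp

lemma theta_poly_smult: "theta_poly (smult k f) = const_op k * theta_poly f"
proof (induction f)
  case (pCons l f)
  have "\<theta> * (const_op k * theta_poly f) = const_op k * (\<theta> * theta_poly f)"
    by (metis mult.assoc theta_const_op)
  with pCons show ?case by (simp add: const_op_mult distrib_left)
qed simp

lemma theta_poly_mult: "theta_poly (f * h) = theta_poly f * theta_poly h"
  by (induction f)
    (simp_all add: theta_poly_add theta_poly_smult distrib_right mult.assoc const_op_0)

lemma theta_poly_uminus: "theta_poly (- f) = - theta_poly f"
  using theta_poly_add[of f "- f"] by (simp add: eq_neg_iff_add_eq_0 add.commute)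

abbreviation shift_poly :: "complex \<Rightarrow> complex poly \<Rightarrow> complex poly" where
  "shift_poly k f \<equiv> f \<circ>\<^sub>p [:k, 1:]"

lemma theta_x: "\<theta> * x_op = x_op * (\<theta> + 1)"
  using theta_x_op[of 0] by (simp add: const_op_0 const_op_1)

lemma D_theta: "\<partial> * \<theta> = (\<theta> + 1) * \<partial>"
  by (simp add: theta_op_def D_op_x_op distrib_right flip: mult.assoc)

lemma theta_poly_x: "theta_poly f * x_op = x_op * theta_poly (shift_poly 1 f)"
proof (induction f)
  case (pCons k f)
  have "\<theta> * theta_poly f * x_op = x_op * (\<theta> + 1) * theta_poly (shift_poly 1 f)"
    using pCons by (metis mult.assoc theta_x)
  then show ?case
    by (simp add: pcompose_pCons theta_poly_add theta_poly_mult distrib_right distrib_left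
        x_op_const_op const_op_1 const_op_0 mult.assoc add.commute)
qed simp

lemma D_theta_poly: "\<partial> * theta_poly f = theta_poly (shift_poly 1 f) * \<partial>"
proof (induction f)
  case (pCons k f)
  have "\<partial> * (\<theta> * theta_poly f) = (\<theta> + 1) * (theta_poly (shift_poly 1 f) * \<partial>)"
    using pCons by (metis mult.assoc D_theta)
  then show ?case
    by (simp add: pcompose_pCons theta_poly_add theta_poly_mult distrib_right distrib_left
        D_op_const_op const_op_1 const_op_0 mult.assoc add.commute)
qed simp

lemma x_theta_poly: "x_op * theta_poly f = theta_poly (shift_poly (-1) f) * x_op"
proof -
  have "shift_poly 1 (shift_poly (-1) f) = f"
    by (simp flip: pcompose_assoc add: pcompose_pCons)
  then show ?thesis by (metis theta_poly_x)
qed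

lemma x_theta_poly_D: "x_op * theta_poly f * \<partial> = theta_poly (shift_poly (-1) f * [:0, 1:])"
proof -
  have "theta_poly [:0, 1:] = x_op * \<partial>"
    by (simp add: theta_op_def const_op_0 const_op_1)
  then show ?thesis by (simp only: theta_poly_mult x_theta_poly mult.assoc)
qed

lemma D_x_theta_poly: "\<partial> * (x_op * theta_poly f) = theta_poly ([:1, 1:] * f)"
proof -
  have "\<partial> * (x_op * theta_poly f) = (\<theta> + 1) * theta_poly f"
    by (simp add: D_op_x_op theta_op_def flip: mult.assoc)
  then show ?thesis
    by (simp only: theta_poly_mult) (simp add: const_op_0 const_op_1 add.commute)
qed

text \<open>The components of degree 1, 0, -1, -2 for the grading in which \<open>x_op\<close> has
  degree 1, \<open>\<partial>\<close> degree -1 and \<open>\<theta>\<close> degree 0.\<close>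

definition graded_op ::
  "complex poly \<Rightarrow> complex poly \<Rightarrow> complex poly \<Rightarrow> complex poly \<Rightarrow> diffop" where
  "graded_op A B C D = x_op * theta_poly A + theta_poly B + theta_poly C * \<partial> + theta_poly D * \<partial>^2"

text \<open>Degrees 2 down to -4 are collected with the rules
  \<open>f(\<theta>) x = x f(\<theta> + 1)\<close>,
  \<open>\<partial> f(\<theta>) = f(\<theta> + 1) \<partial>\<close>,
  \<open>x f(\<theta>) \<partial> = f(\<theta> - 1) \<theta>\<close> and
  \<open>\<partial> x = \<theta> + 1\<close>.\<close>

lemma graded_op_mult:
  "graded_op A B C D * graded_op A' B' C' D' =
     x_op * (x_op * theta_poly (shift_poly 1 A * A'))
   + x_op * theta_poly (A * B' + shift_poly 1 B * A')
   + theta_poly (shift_poly (-1) (A * C') * [:0, 1:] + B * B' + C * ([:1, 1:] * A'))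
   + theta_poly (shift_poly (-1) (A * D') * [:0, 1:] + B * C' + C * shift_poly 1 B'
       + D * shift_poly 1 ([:1, 1:] * A')) * \<partial>
   + theta_poly (B * D' + C * shift_poly 1 C' + D * shift_poly 1 (shift_poly 1 B')) * \<partial>^2
   + theta_poly (C * shift_poly 1 D' + D * shift_poly 1 (shift_poly 1 C')) * \<partial>^3
   + theta_poly (D * shift_poly 1 (shift_poly 1 D')) * \<partial>^4"
proof -
  have merge: "theta_poly f * (theta_poly h * Z) = theta_poly (f * h) * Z"
    and merge': "theta_poly f * theta_poly h = theta_poly (f * h)" for f h Z
    by (simp_all add: theta_poly_mult mult.assoc)
  have x: "theta_poly f * (x_op * Z) = x_op * (theta_poly (shift_poly 1 f) * Z)" for f Z
    using theta_poly_x by (metis mult.assoc)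
  have d: "\<partial> * (theta_poly f * Z) = theta_poly (shift_poly 1 f) * (\<partial> * Z)" for f Z
    using D_theta_poly by (metis mult.assoc)
  have xd: "x_op * (theta_poly f * (\<partial> * Z)) = theta_poly (shift_poly (-1) f * [:0, 1:]) * Z"
    and xd': "x_op * (theta_poly f * \<partial>) = theta_poly (shift_poly (-1) f * [:0, 1:])" for f Z
    using x_theta_poly_D by (metis mult.assoc)+
  show ?thesis
    unfolding graded_op_def power2_eq_square power3_eq_cube power4_eq_xxxx
    by (simp only: distrib_left distrib_right mult.assoc merge merge' x d D_theta_poly xd xd'
        D_x_theta_poly theta_poly_add add_ac)
qed

section \<open>Symbols and orders of graded operators\<close>

lemma symbol_0 [simp]: "symbol 0 = 0"
  by (simp add: zero_diffop_def)

lemma symbol_mult_D: "symbol (A * \<partial>) = pCons 0 (symbol A)"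
proof -
  have "(D_symbol ^^ i) [:0, 1:] = monom 1 (Suc i)" for i
    using D_symbol_pow_1[of "Suc i"] D_symbol_pow_1[of 1]
    by (simp add: funpow_swap1 monom_altdef)
  then have "symbol (A * \<partial>) = (\<Sum>i\<le>degree (symbol A). monom (coeff (symbol A) i) (Suc i))"
    by (simp add: times_diffop_def D_op_def mult_symbol_def smult_monom)
  also have "\<dots> = pCons 0 (\<Sum>i\<le>degree (symbol A). monom (coeff (symbol A) i) i)"
    by (rule poly_eqI) (simp add: coeff_sum coeff_pCons split: nat.split)
  finally show ?thesis by (simp add: poly_as_sum_of_monoms)
qed

lemma symbol_x_mult: "symbol (x_op * A) = smult (to_fract [:0, 1:]) (symbol A)"
  by (simp add: x_op_def mult_op_def times_diffop_def mult_symbol_def)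

lemma symbol_add: "symbol (A + B) = symbol A + symbol B"
  by (simp add: plus_diffop_def)

lemma symbol_theta_mult:
  "symbol (\<theta> * A) = smult (to_fract [:0, 1:]) (D_symbol (symbol A))"
  by (simp add: theta_op_def mult.assoc symbol_x_mult)
    (simp add: D_op_def times_diffop_def mult_symbol_def)

lemma coeff_symbol_theta_poly:
  assumes "degree f \<le> n"
  shows "coeff (symbol (theta_poly f)) n = to_fract (monom (coeff f n) n)"
  using assms
proof (induction f arbitrary: n)
  case 0
  then show ?case by simp
next
  case (pCons k f)
  have const: "coeff (symbol (const_op k)) n = (if n = 0 then to_fract [:k:] else 0)"
    by (simp add: const_op_def mult_op_def coeff_pCons split: nat.split)
  show ?case
  proof (cases "f = 0")
    case True
    then show ?thesis
      using const by (simp add: symbol_add monom_0 coeff_pCons split: nat.split)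
  next
    case False
    with pCons.prems obtain m where m: "n = Suc m" "degree f \<le> m"
      by (cases n) auto
    then have "coeff (symbol (theta_poly f)) n = 0"
      using pCons.IH[of n] by (simp add: coeff_eq_0)
    then show ?thesis
      using m const pCons.IH[of m]
      by (simp add: symbol_add symbol_theta_mult coeff_D_symbol monom_Suc flip: to_fract_mult)
  qed
qed

text \<open>In the coefficient of \<open>\<partial>^n\<close> the four components contribute the
  distinct powers n+1, n, n-1, n-2 of x, so the nonzero term from \<open>B\<close> cannot cancel.
  The alternative \<open>D = 0\<close> admits operators of order 1, since the zero polynomial has
  degree 0.\<close>

lemma order_graded_op:
  assumes "degree A \<le> n" "degree B = n" "degree C < n" "D = 0 \<or> degree D + 2 \<le> n"
  shows "diffop_order (graded_op A B C D) = n"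
proof -
  define top where "top = (\<lambda>m. pCons 0 (monom (coeff A m) m) + monom (coeff B m) m
    + monom (coeff C (m - 1)) (m - 1) + monom (coeff D (m - 2)) (m - 2))"
  have coeff: "coeff (symbol (graded_op A B C D)) m = to_fract (top m)" if "n \<le> m" for m
  proof -
    have xA: "coeff (symbol (x_op * theta_poly A)) m = to_fract (pCons 0 (monom (coeff A m) m))"
      using coeff_symbol_theta_poly[of A m] assms that
      by (simp add: symbol_x_mult flip: to_fract_mult)
    have C: "coeff (symbol (theta_poly C * \<partial>)) m = to_fract (monom (coeff C (m - 1)) (m - 1))"
      using coeff_symbol_theta_poly[of C "m - 1"] assms that
      by (cases m) (simp_all add: symbol_mult_D)
    have D: "coeff (symbol (theta_poly D * \<partial>^2)) m = to_fract (monom (coeff D (m - 2)) (m - 2))"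
    proof (cases "D = 0")
      case True
      then show ?thesis by simp
    next
      case False
      then have "degree D + 2 \<le> m" using assms(4) that by simp
      then obtain k where "m = Suc (Suc k)" "degree D \<le> k"
        by (metis Suc_le_mono add_2_eq_Suc' Suc_le_D)
      then show ?thesis
        using coeff_symbol_theta_poly[of D k]
        by (simp add: power2_eq_square symbol_mult_D flip: mult.assoc)
    qed
    show ?thesis
      using coeff_symbol_theta_poly[of B m] assms that
      by (simp add: graded_op_def symbol_add xA C D top_def to_fract_add)
  qed
  have "degree (symbol (graded_op A B C D)) \<le> n"
  proof (rule degree_le, intro allI impI)
    fix m assume "n < m"
    then have "coeff A m = 0" "coeff B m = 0" "coeff C (m - 1) = 0"
      using assms by (auto intro!: coeff_eq_0)
    moreover have "coeff D (m - 2) = 0"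
      using assms(4) \<open>n < m\<close> by (cases "D = 0") (auto intro!: coeff_eq_0)
    ultimately show "coeff (symbol (graded_op A B C D)) m = 0"
      using coeff[of m] \<open>n < m\<close> by (simp add: top_def)
  qed
  moreover have "coeff (top n) n = coeff B n"
    using assms by (cases n) (auto simp: top_def coeff_pCons)
  then have "coeff (symbol (graded_op A B C D)) n \<noteq> 0"
    using coeff[of n] assms by auto
  then have "n \<le> degree (symbol (graded_op A B C D))"
    by (rule le_degree)
  ultimately show ?thesis by (simp add: diffop_order_def)
qed

text \<open>One identity for each degree from 2 to -4. Polynomials over an infinite field are
  determined by their values, and in terms of values the identities can be decided by
  \<open>algebra\<close>.\<close>

lemma graded_op_mult_eqI:
  assumes "\<And>t. poly A (t + 1) * poly A' t = poly E (t + 1) * poly E' t"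
    and "\<And>t. poly A t * poly B' t + poly B (t + 1) * poly A' t
      = poly E t * poly F' t + poly F (t + 1) * poly E' t"
    and "\<And>t. t * (poly A (t - 1) * poly C' (t - 1)) + poly B t * poly B' t + (t + 1) * (poly C t * poly A' t)
      = t * (poly E (t - 1) * poly G' (t - 1)) + poly F t * poly F' t + (t + 1) * (poly G t * poly E' t)"
    and "\<And>t. t * (poly A (t - 1) * poly D' (t - 1)) + poly B t * poly C' t + poly C t * poly B' (t + 1)
        + (t + 2) * (poly D t * poly A' (t + 1))
      = t * (poly E (t - 1) * poly H' (t - 1)) + poly F t * poly G' t + poly G t * poly F' (t + 1)
        + (t + 2) * (poly H t * poly E' (t + 1))"
    and "\<And>t. poly B t * poly D' t + poly C t * poly C' (t + 1) + poly D t * poly B' (t + 2)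
      = poly F t * poly H' t + poly G t * poly G' (t + 1) + poly H t * poly F' (t + 2)"
    and "\<And>t. poly C t * poly D' (t + 1) + poly D t * poly C' (t + 2)
      = poly G t * poly H' (t + 1) + poly H t * poly G' (t + 2)"
    and "\<And>t. poly D t * poly D' (t + 2) = poly H t * poly H' (t + 2)"
  shows "graded_op A B C D * graded_op A' B' C' D' = graded_op E F G H * graded_op E' F' G' H'"
proof -
  have cong: "theta_poly f = theta_poly h" if "\<And>t. poly f t = poly h t" for f h
    using that by (metis poly_eq_poly_eq_iff ext)
  have shift: "poly f (t + 1 + 1) = poly f (t + 2)" for f and t :: complex
    by (simp add: add.assoc)
  note eval = poly_pcompose poly_mult poly_add poly_pCons poly_0
  show ?thesis
    unfolding graded_op_mult
    apply (intro arg_cong2[of _ _ _ _ "(+)"] arg_cong2[of _ _ _ _ "(*)"] cong refl)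
    subgoal for t using assms(1)[of t] by (simp add: eval add.commute)
    subgoal for t using assms(2)[of t] by (simp add: eval add.commute)
    subgoal for t using assms(3)[of t] by (simp add: eval algebra_simps)
    subgoal for t using assms(4)[of t] by (simp add: eval algebra_simps)
    subgoal for t using assms(5)[of t] by (simp add: eval algebra_simps)
    subgoal for t using assms(6)[of t] by (simp add: eval algebra_simps)
    subgoal for t using assms(7)[of t] by (simp add: eval algebra_simps)
    done
qed

lemma reducible_op_right_factor:
  assumes "A = F * G" "0 < diffop_order G" "diffop_order G < diffop_order A"
  shows "reducible_op A"
proof -
  have "F \<noteq> 0" "G \<noteq> 0" using assms by auto
  then have "diffop_order A = diffop_order F + diffop_order G"
    using assms(1) diffop_order_mult by blast
  then show ?thesis
    using assms unfolding reducible_op_def by (intro exI[of _ F] exI[of _ G]) simp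
qed

section \<open>Operators of the shape of \<open>E\<^sub>5\<close>\<close>

abbreviation lin :: "complex \<Rightarrow> complex poly" where
  "lin k \<equiv> [:k, 1:]"

text \<open>The shape common to all \<open>E\<^sub>5\<close>: \<open>f\<close>, \<open>u\<close>, \<open>v\<close>, \<open>w\<close> are \<open>(\<theta> + e\<^sub>7 + 1)(\<theta> + e\<^sub>8 + 1)\<close>,
  \<open>B\<^sub>1\<close>, \<open>B\<^sub>2\<close>, \<open>T\<^sub>3\<close> as polynomials in \<open>\<theta>\<close>. For \<open>SE\<^sub>5\<close> they do not involve \<open>p\<close>,
  which enters only through \<open>s = -r\<close>.\<close>

definition e5_op ::
  "complex \<Rightarrow> complex poly \<Rightarrow> complex poly \<Rightarrow> complex poly \<Rightarrow> complex poly \<Rightarrow> diffop" where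
  "e5_op s f u v w = graded_op (lin (s + 1) * lin (s + 2) * lin (s + 3) * f)
     (lin (s + 1) * lin (s + 2) * u) (lin (s + 2) * v) w"

lemmas poly_eval = poly_mult poly_add poly_minus poly_pCons poly_0 poly_1
  mult_zero_left mult_zero_right add_0_left add_0_right

lemma graded_op_unit: "graded_op 0 1 0 0 = 1"
  by (simp add: graded_op_def)

lemma degree_lin_mult_le: "degree f \<le> n \<Longrightarrow> degree (lin k * f) \<le> Suc n"
  using degree_mult_le[of "lin k" f] by simp

lemma degree_lin_mult: "f \<noteq> 0 \<Longrightarrow> degree (lin k * f) = Suc (degree f)"
  by (subst degree_mult_eq) auto

locale e5_coeffs =
  fixes f u v w :: "complex poly"
  assumes degree_f: "degree f \<le> 2" and degree_u: "degree u = 3"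
    and degree_v: "degree v \<le> 3" and degree_w: "degree w \<le> 3"
begin

lemma order_e5_op: "diffop_order (e5_op s f u v w) = 5"
  unfolding e5_op_def
proof (rule order_graded_op)
  show "degree (lin (s + 1) * lin (s + 2) * lin (s + 3) * f) \<le> 5"
    unfolding mult.assoc
    using degree_lin_mult_le[OF degree_lin_mult_le[OF degree_lin_mult_le[OF degree_f]]] by simp
  have "u \<noteq> 0" using degree_u by auto
  then show "degree (lin (s + 1) * lin (s + 2) * u) = 5"
    using degree_u by (simp only: mult.assoc) (simp add: degree_lin_mult del: mult_pCons_left)
  show "degree (lin (s + 2) * v) < 5"
    using degree_lin_mult_le[OF degree_v, of "s + 2"] by simp
  show "w = 0 \<or> degree w + 2 \<le> 5"
    using degree_w by simp
qed

text \<open>Here \<open>graded_op 0 1 0 0\<close> is the identity operator; it turns a factorization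
  into an equality of two products, the form that \<open>graded_op_mult_eqI\<close> handles.\<close>

lemma reducible_e5_op_right_factor:
  assumes "F * G = e5_op s f u v w * graded_op 0 1 0 0" "diffop_order G = n" "0 < n" "n < 5"
  shows "reducible_op (e5_op s f u v w)"
  using assms by (intro reducible_op_right_factor[of _ F G]) (simp_all add: graded_op_unit order_e5_op)

end

text \<open>Passing from \<open>s\<close> to \<open>s + 1\<close> only shifts the chain of factors
  \<theta>+s+k. Multiplication by \<theta>+s+1 on the right and by \<theta>+s+3 on the left
  completes both chains to the same product in every degree.\<close>

lemma reducible_e5_op_p_shift:
  assumes "e5_coeffs f u v w"
  shows "reducible_op (e5_op (s + 1) f u v w) \<longleftrightarrow> reducible_op (e5_op s f u v w)"
proof (rule reducible_op_intertwine)
  interpret e5_coeffs by fact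
  let ?H = "graded_op 0 (lin (s + 1)) 0 0"
  show "e5_op (s + 1) f u v w * ?H = graded_op 0 (lin (s + 3)) 0 0 * e5_op s f u v w"
    unfolding e5_op_def by (rule graded_op_mult_eqI) (simp_all only: poly_eval, algebra+)
  have "diffop_order ?H = 1" by (rule order_graded_op) auto
  then show "?H \<noteq> 0" "diffop_order ?H < diffop_order (e5_op s f u v w)"
    by (auto simp: order_e5_op)
  show "diffop_order (e5_op (s + 1) f u v w) = diffop_order (e5_op s f u v w)"
    by (simp add: order_e5_op)
qed

text \<open>The intertwiner is \<theta>+s+1-\<partial>. In each degree the factors \<theta>+s+k
  cancel, and the four assumed identities are what remains.\<close>

lemma reducible_e5_op_q_shift:
  assumes "e5_coeffs f u v w" "e5_coeffs f u' v' w'"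
    and u: "\<And>t. poly u' t - t * poly f (t - 1) = poly u t - (t + 1) * poly f t"
    and v: "\<And>t. poly v' t - poly u' t = poly v t - poly u (t + 1)"
    and w: "\<And>t. poly w' t - poly v' t = poly w t - poly v (t + 1)"
    and w': "\<And>t. poly w' t = poly w (t + 1)"
  shows "reducible_op (e5_op (s + 1) f u' v' w') \<longleftrightarrow> reducible_op (e5_op s f u v w)"
proof (rule reducible_op_intertwine)
  interpret e5_coeffs f u v w by fact
  interpret sh: e5_coeffs f u' v' w' by fact
  let ?H = "graded_op 0 (lin (s + 1)) (-1) 0"
  have u': "poly u' t = poly u t - (t + 1) * poly f t + t * poly f (t - 1)" for t
    using u[of t] by algebra
  have v': "poly v' t = poly v t - poly u (t + 1) + poly u' t" for t
    using v[of t] by algebra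
  have w'': "poly w (t + 1) = poly w t - poly v (t + 1) + poly v' t" for t
    using w[of t] w'[of t] by algebra
  show "e5_op (s + 1) f u' v' w' * ?H = graded_op 0 (lin (s + 3)) (-1) 0 * e5_op s f u v w"
    unfolding e5_op_def
    apply (rule graded_op_mult_eqI; simp only: poly_eval w')
    subgoal by algebra
    subgoal for t unfolding u'[of t] by algebra
    subgoal for t unfolding v'[of t] by algebra
    subgoal for t unfolding w''[of t] by algebra
    subgoal by algebra
    done
  have "diffop_order ?H = 1" by (rule order_graded_op) auto
  then show "?H \<noteq> 0" "diffop_order ?H < diffop_order (e5_op s f u v w)"
    by (auto simp: order_e5_op)
  show "diffop_order (e5_op (s + 1) f u' v' w') = diffop_order (e5_op s f u v w)"
    by (simp add: order_e5_op sh.order_e5_op)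
qed

text \<open>The factors \<open>\<theta> + s + k\<close> of the two operators, of \<open>H\<close> and of \<open>K\<close> cancel in every degree,
  which leaves identities free of \<open>s\<close>.\<close>

lemma reducible_e5_op_shift_2:
  assumes "e5_coeffs f u v w" "e5_coeffs f' u' v' w'"
    and "degree p0 = 2" "degree p1 \<le> 2" "degree p2 \<le> 2"
    and "\<And>t. poly f' t * poly p0 t = poly q0 (t + 1) * poly f t"
    and "\<And>t. t * poly f' (t - 1) * poly p1 (t - 1) + poly u' t * poly p0 t
      = poly q0 t * poly u t + (t + 1) * poly q1 t * poly f t"
    and "\<And>t. t * poly f' (t - 1) * poly p2 (t - 1) + poly u' t * poly p1 t + poly v' t * poly p0 (t + 1)
      = poly q0 t * poly v t + poly q1 t * poly u (t + 1) + (t + 2) * poly q2 t * poly f (t + 1)"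
    and "\<And>t. poly u' t * poly p2 t + poly v' t * poly p1 (t + 1) + poly w' t * poly p0 (t + 2)
      = poly q0 t * poly w t + poly q1 t * poly v (t + 1) + poly q2 t * poly u (t + 2)"
    and "\<And>t. poly v' t * poly p2 (t + 1) + poly w' t * poly p1 (t + 2)
      = poly q1 t * poly w (t + 1) + poly q2 t * poly v (t + 2)"
    and "\<And>t. poly w' t * poly p2 (t + 2) = poly q2 t * poly w (t + 2)"
  shows "reducible_op (e5_op (s + 2) f' u' v' w') \<longleftrightarrow> reducible_op (e5_op s f u v w)"
proof (rule reducible_op_intertwine)
  interpret e5_coeffs f u v w by fact
  interpret sh: e5_coeffs f' u' v' w' by fact
  let ?H = "graded_op 0 (lin (s + 1) * lin (s + 2) * p0) (lin (s + 2) * p1) p2"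
  let ?K = "graded_op 0 (lin (s + 3) * lin (s + 4) * q0) (lin (s + 4) * q1) q2"
  show "e5_op (s + 2) f' u' v' w' * ?H = ?K * e5_op s f u v w"
    unfolding e5_op_def
    apply (rule graded_op_mult_eqI; (simp only: poly_eval)?)
    subgoal for t using assms(6)[of t] by algebra
    subgoal for t using assms(7)[of t] by algebra
    subgoal for t using assms(8)[of t] by algebra
    subgoal for t using assms(9)[of t] by algebra
    subgoal for t using assms(10)[of t] by algebra
    subgoal by (rule assms(11))
    done
  have "p0 \<noteq> 0" using assms(3) by auto
  then have "degree (lin (s + 1) * lin (s + 2) * p0) = 4"
    using assms(3) by (simp only: mult.assoc) (simp add: degree_lin_mult del: mult_pCons_left)
  then have "diffop_order ?H = 4"
    using assms(4,5) degree_lin_mult_le[OF assms(4), of "s + 2"] by (intro order_graded_op) auto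
  then show "?H \<noteq> 0" "diffop_order ?H < diffop_order (e5_op s f u v w)"
    by (auto simp: order_e5_op)
  show "diffop_order (e5_op (s + 2) f' u' v' w') = diffop_order (e5_op s f u v w)"
    by (simp add: order_e5_op sh.order_e5_op)
qed

section \<open>Criteria for explicit right factors of \<open>e5_op\<close>\<close>

lemma reducible_e5_op_D_factor:
  assumes "e5_coeffs f u v w"
    and "lin (s + 1) * lin (s + 2) * lin (s + 3) * f = h * [:0, 1:]"
    and "lin (s + 1) * lin (s + 2) * u = k * [:0, 1:]"
  shows "reducible_op (e5_op s f u v w)"
proof -
  interpret e5_coeffs by fact
  have "theta_poly (l * [:0, 1:]) = theta_poly l * x_op * \<partial>" for l
    by (simp only: theta_poly_mult) (simp add: const_op_0 const_op_1 theta_op_def mult.assoc)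
  \<comment> \<open>The components of degree 1 and 0 end in \<theta> = x \<partial> by assumption,
    the others in \<partial> by their form.\<close>
  then have eq: "e5_op s f u v w = (x_op * (theta_poly h * x_op) + theta_poly k * x_op
      + theta_poly (lin (s + 2) * v) + theta_poly w * \<partial>) * \<partial>"
    unfolding e5_op_def graded_op_def assms(2,3)
    by (simp add: distrib_right mult.assoc power2_eq_square)
  have "diffop_order \<partial> = 1"
    by (simp add: diffop_order_def D_op_def)
  then show ?thesis
    by (intro reducible_op_right_factor[OF eq]) (simp_all add: order_e5_op)
qed

text \<open>Moving \<partial> once or twice past \<theta>+s+1 gives \<theta>+s+2 or \<theta>+s+3.
  All components but the last contain the required factor already.\<close>

lemma reducible_e5_op_theta_factor:
  assumes "e5_coeffs f u v w" and w: "w = lin (s + 3) * h"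
  shows "reducible_op (e5_op s f u v w)"
proof -
  interpret e5_coeffs by fact
  let ?G = "graded_op 0 (lin (s + 1)) 0 0"
  have "graded_op (lin (s + 2) * lin (s + 3) * f) (lin (s + 2) * u) v h * ?G
      = e5_op s f u v w * graded_op 0 1 0 0"
    unfolding e5_op_def w
    by (rule graded_op_mult_eqI; (simp only: poly_eval)?; algebra)
  moreover have "diffop_order ?G = 1" by (rule order_graded_op) auto
  ultimately show ?thesis
    by (rule reducible_e5_op_right_factor) simp_all
qed

text \<open>Dividing by \<theta>+s+1-\<partial> from the top degree downwards determines the
  cofactor; the hypothesis says that the last degree leaves no remainder. The term \<open>?f\<close>
  is \<open>x f(\<theta>) \<partial>\<close> written as a polynomial in \<theta>.\<close>

lemma reducible_e5_op_theta_minus_D_factor: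
  assumes "e5_coeffs f u v w"
    and 0: "\<And>t. poly u t + poly v t + poly w t + t * poly f (t - 1) = 0"
  shows "reducible_op (e5_op s f u v w)"
proof -
  interpret e5_coeffs by fact
  let ?G = "graded_op 0 (lin (s + 1)) (-1) 0"
  let ?f = "[:0, 1:] * shift_poly (-1) f"
  have f: "poly (shift_poly (-1) f) t = poly f (t - 1)" for t
    by (simp add: poly_pcompose)
  have w: "poly w t = - poly u t - poly v t - t * poly f (t - 1)" for t
    using 0[of t] by algebra
  have "graded_op (lin (s + 2) * lin (s + 3) * f) (lin (s + 2) * (u + ?f)) (u + v + ?f) 0 * ?G
      = e5_op s f u v w * graded_op 0 1 0 0"
    unfolding e5_op_def
    by (rule graded_op_mult_eqI; simp only: poly_eval w f; algebra)
  moreover have "diffop_order ?G = 1" by (rule order_graded_op) auto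
  ultimately show ?thesis
    by (rule reducible_e5_op_right_factor) simp_all
qed

text \<open>The right factor (\<theta>+s+1)(\<theta>+\<alpha>) - (\<theta>+\<gamma>-1)\<partial> is
  a Gauss hypergeometric operator. The hypotheses on \<open>u\<close> and \<open>v\<close> are the
  components of degree 0 and -1 after cancelling the factors with \<open>s\<close>.\<close>

lemma reducible_e5_op_gauss_factor:
  assumes "e5_coeffs f u v w" and f: "f = lin \<alpha> * lin \<beta>" and w: "w = - (lin \<gamma> * k)"
    and u: "\<And>t. poly u t = poly h t * (t + \<alpha>) - t * (t + \<beta> - 1) * (t + \<gamma> - 2)"
    and v: "\<And>t. poly v t = poly k t * (t + \<alpha> + 1) - poly h t * (t + \<gamma> - 1)"
  shows "reducible_op (e5_op s f u v w)"
proof -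
  interpret e5_coeffs by fact
  let ?G = "graded_op 0 (lin (s + 1) * lin \<alpha>) (- lin (\<gamma> - 1)) 0"
  have "graded_op (lin (s + 2) * lin (s + 3) * lin \<beta>) (lin (s + 2) * h) k 0 * ?G
      = e5_op s f u v w * graded_op 0 1 0 0"
    unfolding e5_op_def f w
    by (rule graded_op_mult_eqI; simp only: poly_eval u v; algebra)
  moreover have "diffop_order ?G = 2"
    by (rule order_graded_op) (auto simp: degree_lin_mult)
  ultimately show ?thesis
    by (rule reducible_e5_op_right_factor) simp_all
qed

text \<open>The right factor x(\<theta>+s+1) - (\<theta>+\<gamma>-2) annihilates
  \<open>x^(2-\<gamma>) (1-x)^(\<gamma>-s-3)\<close>.\<close>

lemma reducible_e5_op_first_order_factor:
  assumes "e5_coeffs f u v w" and f: "f = lin \<alpha> * lin \<beta>" and w: "w = - (lin \<gamma> * k)"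
    and u: "\<And>t. poly u t = poly h t * (t + 1) - (t + \<alpha> - 1) * (t + \<beta> - 1) * (t + \<gamma> - 2)"
    and v: "\<And>t. poly v t = poly k t * (t + 2) - poly h t * (t + \<gamma> - 1)"
  shows "reducible_op (e5_op s f u v w)"
proof -
  interpret e5_coeffs by fact
  let ?G = "graded_op (lin (s + 1)) (- lin (\<gamma> - 2)) 0 0"
  have "graded_op 0 (lin (s + 1) * lin (s + 2) * lin (\<alpha> - 1) * lin (\<beta> - 1)) (lin (s + 2) * h) k * ?G
      = e5_op s f u v w * graded_op 0 1 0 0"
    unfolding e5_op_def f w
    by (rule graded_op_mult_eqI; simp only: poly_eval u v; algebra)
  moreover have "diffop_order ?G = 1" by (rule order_graded_op) auto
  ultimately show ?thesis
    by (rule reducible_e5_op_right_factor) simp_all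
qed

section \<open>Shifts and factorizations of \<open>SE\<^sub>5\<close>\<close>

abbreviation SE5_exps9 where
  "SE5_exps9 a b c g p q \<equiv> (SE5_exps a b c g p q)(9 := 0)"

lemma SE5_exps9_simps:
  "SE5_exps9 a b c g p q 1 = -2*a - 2*b - 2*c - g - q - 2"
  "SE5_exps9 a b c g p q 2 = -a - c - 2*b - g - q - 1"
  "SE5_exps9 a b c g p q 3 = -2*b - q"
  "SE5_exps9 a b c g p q 4 = -2*a - 2*b - 2*c - g - p - 2"
  "SE5_exps9 a b c g p q 5 = -b - c - 2*a - g - p - 1"
  "SE5_exps9 a b c g p q 6 = -2*a - p"
  "SE5_exps9 a b c g p q 7 = 2*a + 2*b + g + 2"
  "SE5_exps9 a b c g p q 8 = a + b + 1"
  "SE5_exps9 a b c g p q 9 = 0"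
  by (simp_all add: SE5_exps_def)

lemma SE5_s1:
  "s11 (SE5_exps9 a b c g p q) = -3*a - 6*b - 3*c - 2*g - 3*q - 3"
  "s12 (SE5_exps9 a b c g p q) = -6*a - 3*b - 3*c - 2*g - 3*p - 3"
  "s13 (SE5_exps9 a b c g p q) = 3*a + 3*b + g + 3"
  unfolding s11_def s12_def s13_def SE5_exps9_simps by simp_all

section \<open>\<open>SE5\<close> in terms of polynomials in \<theta>\<close>

definition SE5_f :: "complex \<Rightarrow> complex \<Rightarrow> complex \<Rightarrow> complex poly" where
  "SE5_f a b g = lin (2*a + 2*b + g + 3) * lin (a + b + 2)"

definition SE5_u :: "complex \<Rightarrow> complex \<Rightarrow> complex \<Rightarrow> complex \<Rightarrow> complex \<Rightarrow> complex poly" where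
  "SE5_u a b c g q = [:
    - 4*a^2*b - 2*a^2*q - 8*a*b^2 - 4*a*b*c - 4*a*b*g - 4*a*b*q - a*g*q - 4*b^3 - 4*b^2*c -
    4*b^2*g - 2*b^2*q - 2*b*c*g - b*g^2 - b*g*q - 6*a^2 - 26*a*b - 4*a*c - 5*a*g - 7*a*q -
    20*b^2 - 10*b*c - 12*b*g - 7*b*q - 2*c*g - g^2 - 2*g*q - 21*a - 33*b - 6*c - 9*g - 6*q - 18,
    - 6*a^2 - 20*a*b - 4*a*c - 5*a*g - 6*a*q - 14*b^2 - 8*b*c - 9*b*g - 6*b*q - 2*c*g - g^2 -
    2*g*q - 30*a - 43*b - 9*c - 13*g - 9*q - 33,
    - 9*a - 12*b - 3*c - 4*g - 3*q - 18,
    -3:]"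

definition SE5_v :: "complex \<Rightarrow> complex \<Rightarrow> complex \<Rightarrow> complex \<Rightarrow> complex \<Rightarrow> complex poly" where
  "SE5_v a b c g q = [:
    8*a^2*b + 4*a^2*q + 20*a*b^2 + 12*a*b*c + 10*a*b*g + 16*a*b*q + 4*a*c*q + 4*a*g*q + 3*a*q^2
    + 12*b^3 + 16*b^2*c + 12*b^2*g + 12*b^2*q + 4*b*c^2 + 8*b*c*g + 8*b*c*q + 3*b*g^2 + 8*b*g*q
    + 3*b*q^2 + 2*c*g*q + g^2*q + g*q^2 + 12*a^2 + 70*a*b + 16*a*c + 14*a*g + 29*a*q + 66*b^2 +
    50*b*c + 41*b*g + 45*b*q + 4*c^2 + 10*c*g + 12*c*q + 4*g^2 + 14*g*q + 6*q^2 + 60*a + 120*b +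
    38*c + 34*g + 42*q + 72,
    6*a^2 + 28*a*b + 8*a*c + 7*a*g + 12*a*q + 24*b^2 + 20*b*c + 16*b*g + 18*b*q + 2*c^2 + 5*c*g
    + 6*c*q + 2*g^2 + 6*g*q + 3*q^2 + 48*a + 87*b + 31*c + 27*g + 33*q + 78,
    9*a + 15*b + 6*c + 5*g + 6*q + 27,
    3:]"

definition SE5_w :: "complex \<Rightarrow> complex \<Rightarrow> complex \<Rightarrow> complex \<Rightarrow> complex \<Rightarrow> complex poly" where
  "SE5_w a b c g q =
    - (lin (2*a + 2*b + 2*c + g + q + 5) * lin (a + 2*b + c + g + q + 4) * lin (2*b + q + 3))"

lemma theta_const_op_left: "\<theta> * (const_op k * A) = const_op k * (\<theta> * A)"
  by (metis mult.assoc theta_const_op)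

lemma B1_theta_poly:
  "B1 e = theta_poly [:T10 e, T11 e, T12 e, T13:]"
  unfolding B1_def
  by (simp only: theta_poly_pCons theta_poly_0 mult_zero_right add_0_left add_0_right distrib_left
      theta_const_op theta_const_op_left power2_eq_square power3_eq_cube mult.assoc add_ac)

lemma B2_theta_poly:
  "B2 e = theta_poly [:T20 e, T21 e, T22 e, T23:]"
  unfolding B2_def
  by (simp only: theta_poly_pCons theta_poly_0 mult_zero_right add_0_left add_0_right distrib_left
      theta_const_op theta_const_op_left power2_eq_square power3_eq_cube mult.assoc add_ac)

lemma SE5_B1:
  "B1 (SE5_exps9 a b c g p q) = theta_poly (SE5_u a b c g q)"
proof -
  let ?e = "SE5_exps9 a b c g p q"
  note defs = s21_def s22_def s23_def s31_def s32_def s33_def SE5_s1 SE5_exps9_simps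
  have "[:T10 ?e, T11 ?e, T12 ?e, T13:] = SE5_u a b c g q"
    unfolding SE5_u_def pCons_eq_iff T10_def T11_def T12_def T13_def defs
    by (intro conjI refl) algebra+
  then show ?thesis by (simp only: B1_theta_poly)
qed

lemma SE5_B2:
  "B2 (SE5_exps9 a b c g p q) = theta_poly (SE5_v a b c g q)"
proof -
  let ?e = "SE5_exps9 a b c g p q"
  note defs = s21_def s22_def s23_def s31_def s32_def s33_def SE5_s1 SE5_exps9_simps
  have "[:T20 ?e, T21 ?e, T22 ?e, T23:] = SE5_v a b c g q"
    unfolding SE5_v_def pCons_eq_iff T20_def T10_def T21_def T22_def T23_def defs
    by (intro conjI refl) algebra+
  then show ?thesis by (simp only: B2_theta_poly)
qed

lemma theta_poly_lin: "theta_poly (lin k) = \<theta> + const_op k"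
  by (simp add: const_op_0 const_op_1 add.commute)

lemma SE5_eq:
  "SE5 a b c g p q = e5_op (2*a + 2*b + 2*c + g + p + q + 3)
     (SE5_f a b g) (SE5_u a b c g q) (SE5_v a b c g q) (SE5_w a b c g q)"
proof -
  let ?e = "SE5_exps9 a b c g p q"
  have s: "s_par ?e = 2*a + 2*b + 2*c + g + p + q + 3"
    using SE5_r_eq[of a b c g p q] unfolding SE5_r_def by algebra
  have e: "?e 7 + 1 = 2*a + 2*b + g + 3" "?e 8 + 1 = a + b + 2"
    "3 - ?e 1 = 2*a + 2*b + 2*c + g + q + 5" "3 - ?e 2 = a + 2*b + c + g + q + 4"
    "3 - ?e 3 = 2*b + q + 3"
    unfolding SE5_exps9_simps by algebra+
  show ?thesis
    unfolding SE5_def E5_def Let_def T0_bar_def T1_bar_def T2_def T3_def SE5_B1 SE5_B2 s e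
      e5_op_def graded_op_def SE5_f_def SE5_w_def
    by (simp only: theta_poly_mult theta_poly_uminus theta_poly_lin mult.assoc add.assoc
        mult_minus_left)
qed

lemma e5_coeffs_SE5: "e5_coeffs (SE5_f a b g) (SE5_u a b c g q) (SE5_v a b c g q) (SE5_w a b c g q)"
proof
  show "degree (SE5_f a b g) \<le> 2" by (simp add: SE5_f_def)
  show "degree (SE5_u a b c g q) = 3" by (simp add: SE5_u_def)
  show "degree (SE5_v a b c g q) \<le> 3" by (simp add: SE5_v_def)
  show "degree (SE5_w a b c g q) \<le> 3" by (simp add: SE5_w_def)
qed

lemmas SE5_poly_defs = SE5_f_def SE5_u_def SE5_v_def SE5_w_def

section \<open>Contiguity relations and the symmetry of \<open>SE5\<close>\<close>

abbreviation (input) SE5_reducible where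
  "SE5_reducible a b c g p q \<equiv> reducible_op (SE5 a b c g p q)"

lemma SE5_p_shift: "SE5_reducible a b c g (p + 1) q \<longleftrightarrow> SE5_reducible a b c g p q"
proof -
  have s: "2*a + 2*b + 2*c + g + (p + 1) + q + 3 = (2*a + 2*b + 2*c + g + p + q + 3) + 1"
    by algebra
  show ?thesis unfolding SE5_eq s by (rule reducible_e5_op_p_shift[OF e5_coeffs_SE5])
qed

lemma SE5_q_shift: "SE5_reducible a b c g p (q + 1) \<longleftrightarrow> SE5_reducible a b c g p q"
proof -
  have s: "2*a + 2*b + 2*c + g + p + (q + 1) + 3 = (2*a + 2*b + 2*c + g + p + q + 3) + 1"
    by algebra
  show ?thesis unfolding SE5_eq s
    by (rule reducible_e5_op_q_shift[OF e5_coeffs_SE5 e5_coeffs_SE5])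
      (simp_all only: SE5_poly_defs poly_eval, algebra+)
qed

text \<open>The coefficients of \<open>p1\<close> and \<open>q1\<close> here and in the next lemma, and of \<open>h\<close> further below, were
  found by solving the linear equations for undetermined coefficients.\<close>

lemma SE5_a_shift: "SE5_reducible (a + 1) b c g p q \<longleftrightarrow> SE5_reducible a b c g p q"
proof -
  define p1 where "p1 = [:
    - 6*a*b - 3*a*q - 6*b^2 - 2*b*c - 3*b*g - 3*b*q - g*q - 8*a - 20*b - 2*c - 4*g - 6*q - 16,
    - 4*a - 7*b - c - 2*g - 2*q - 12, -2:]"
  define q1 where "q1 = [:
    - 6*a*b - 3*a*q - 6*b^2 - 2*b*c - 3*b*g - 3*b*q - g*q - 9*a - 23*b - 2*c - 4*g - 7*q - 21,
    - 4*a - 7*b - c - 2*g - 2*q - 14, -2:]"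
  have s: "2*(a + 1) + 2*b + 2*c + g + p + q + 3 = (2*a + 2*b + 2*c + g + p + q + 3) + 2"
    by algebra
  show ?thesis unfolding SE5_eq s
    \<comment> \<open>The two outermost identities are solved by matching linear factors:
      \<open>p0\<close> is \<open>SE5_f a b g\<close>, and \<open>p2\<close> omits the factor of
      \<open>SE5_w\<close> whose shift by 2 already agrees on both sides.\<close>
    by (rule reducible_e5_op_shift_2[where
          ?p0.0 = "lin (2*a + 2*b + g + 3) * lin (a + b + 2)"
          and ?q0.0 = "lin (2*a + 2*b + g + 4) * lin (a + b + 2)"
          and ?p1.0 = p1 and ?q1.0 = q1
          and ?p2.0 = "lin (a + 2*b + c + g + q + 4) * lin (2*b + q + 3)"
          and ?q2.0 = "lin (a + 2*b + c + g + q + 5) * lin (2*b + q + 3)",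
          OF e5_coeffs_SE5 e5_coeffs_SE5])
      (simp_all only: SE5_poly_defs poly_eval p1_def q1_def, simp, simp, simp, algebra+)
qed

lemma SE5_g_shift: "SE5_reducible a b (c - 1) (g + 2) (p + 1) (q + 1) \<longleftrightarrow> SE5_reducible a b c g p q"
proof -
  define p1 where "p1 = [:
    - 4*a*b + 2*a*g - 2*a*q - 4*b^2 - 4*b*c - 2*b*q + g^2 - 6*a - 14*b - 4*c + g - 4*q - 12,
    - 4*a - 6*b - 2*c - g - 2*q - 11, -2:]"
  define q1 where "q1 = [:
    - 4*a*b + 2*a*g - 2*a*q - 4*b^2 - 4*b*c - 2*b*q + g^2 - 6*a - 14*b - 4*c + 3*g - 4*q - 12,
    - 4*a - 6*b - 2*c - g - 2*q - 13, -2:]"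
  have s: "2*a + 2*b + 2*(c - 1) + (g + 2) + (p + 1) + (q + 1) + 3 = (2*a + 2*b + 2*c + g + p + q + 3) + 2"
    by algebra
  show ?thesis unfolding SE5_eq s
    \<comment> \<open>The factor with \<open>a + b + 2\<close> is common to both
      \<open>SE5_f\<close>, so the top identity leaves one linear factor of \<open>p0\<close> free;
      \<theta>-g is a choice for which the remaining identities are solvable.\<close>
    by (rule reducible_e5_op_shift_2[where
          ?p0.0 = "lin (2*a + 2*b + g + 3) * lin (- g)"
          and ?q0.0 = "lin (2*a + 2*b + g + 4) * lin (- g - 1)"
          and ?p1.0 = p1 and ?q1.0 = q1
          and ?p2.0 = "lin (2*a + 2*b + 2*c + g + q + 5) * lin (2*b + q + 3)"
          and ?q2.0 = "lin (2*a + 2*b + 2*c + g + q + 6) * lin (2*b + q + 4)",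
          OF e5_coeffs_SE5 e5_coeffs_SE5])
      (simp_all only: SE5_poly_defs poly_eval p1_def q1_def, simp, simp, simp, algebra+)
qed

text \<open>In the double integral behind \<open>SE\<^sub>5\<close> the parameter \<open>d\<close> is the exponent at infinity; the
  Moebius transformation exchanging \<open>0\<close> with \<open>1\<close> and \<open>x\<close> with \<open>\<infinity>\<close> swaps \<open>a\<close> with \<open>b\<close>
  and \<open>c\<close> with \<open>d\<close>.\<close>

lemma SE5_sym:
  assumes "d = - (a + b + c + g + 2)"
  shows "SE5 b a d g (p + 2*a + 2*c + g + 2) (q + 2*b + 2*c + g + 2) = SE5 a b c g p q"
proof -
  let ?q = "q + 2*b + 2*c + g + 2"
  have f: "SE5_f b a g = SE5_f a b g"
    unfolding SE5_f_def by (simp only: add.commute add.left_commute)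
  have u: "SE5_u b a d g ?q = SE5_u a b c g q"
    unfolding SE5_u_def pCons_eq_iff assms by (intro conjI refl) algebra+
  have v: "SE5_v b a d g ?q = SE5_v a b c g q"
    unfolding SE5_v_def pCons_eq_iff assms by (intro conjI refl) algebra+
  have e: "2*b + 2*a + 2*d + g + ?q + 5 = 2*b + q + 3" "b + 2*a + d + g + ?q + 4 = a + 2*b + c + g + q + 4"
    "2*a + ?q + 3 = 2*a + 2*b + 2*c + g + q + 5"
    unfolding assms by algebra+
  have w: "SE5_w b a d g ?q = SE5_w a b c g q"
    unfolding SE5_w_def e by (simp only: mult_ac)
  have s: "2*b + 2*a + 2*d + g + (p + 2*a + 2*c + g + 2) + ?q + 3 = 2*a + 2*b + 2*c + g + p + q + 3"
    unfolding assms by algebra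
  show ?thesis unfolding SE5_eq f u v w s ..
qed

section \<open>Explicit right factors of \<open>SE5\<close> at special parameter values\<close>

lemma SE5_w_perm:
  "SE5_w a b c g q = - (lin (2*a + 2*b + 2*c + g + q + 5) * (lin (a + 2*b + c + g + q + 4) * lin (2*b + q + 3)))"
  "SE5_w a b c g q = - (lin (a + 2*b + c + g + q + 4) * (lin (2*a + 2*b + 2*c + g + q + 5) * lin (2*b + q + 3)))"
  "SE5_w a b c g q = - (lin (2*b + q + 3) * (lin (2*a + 2*b + 2*c + g + q + 5) * lin (a + 2*b + c + g + q + 4)))"
  unfolding SE5_w_def by (simp_all only: mult_ac)

text \<open>Like \<open>SE5_w_perm\<close>, it selects which linear factor takes the role of
  \<alpha> or \<gamma> in the factor criteria.\<close>

lemma SE5_f_perm: "SE5_f a b g = lin (a + b + 2) * lin (2*a + 2*b + g + 3)"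
  unfolding SE5_f_def by (rule mult.commute)

text \<open>The right factor annihilates \<open>x^(-2*b-2*c-g-q-3) (1-x)^(-p-1)\<close>.\<close>

lemma SE5_reducible_a: "SE5_reducible 0 b c g p q"
proof -
  define h where "h = [:
    - 6*b^2 - 2*b*c - 3*b*g - 3*b*q - g*q - 17*b - 2*c - 4*g - 4*q - 12,
    - 7*b - c - 2*g - 2*q - 10, -2:]"
  show ?thesis
    unfolding SE5_eq
    by (rule reducible_e5_op_first_order_factor[where h = h, OF e5_coeffs_SE5 SE5_f_def SE5_w_perm(1)])
      (simp_all only: SE5_u_def SE5_v_def poly_eval h_def power_zero_numeral power_one, algebra+)
qed

text \<open>The right factor annihilates \<open>x^(-2*b-q-1) (1-x)^(-2*a-p-1)\<close>.\<close>

lemma SE5_reducible_c_half_g: "SE5_reducible a b c (- 2*c - 2) p q"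
proof -
  define h where "h = [:
    - 4*a^2 - 10*a*b + 4*a*c - 3*a*q - 6*b^2 + 4*b*c - 3*b*q + 2*c*q - 9*a - 11*b + 6*c - 2*q -
    4,
    - 6*a - 7*b + 3*c - 2*q - 6, -2:]"
  show ?thesis
    unfolding SE5_eq
    by (rule reducible_e5_op_first_order_factor[where h = h, OF e5_coeffs_SE5 SE5_f_def SE5_w_perm(3)])
      (simp_all only: SE5_u_def SE5_v_def poly_eval h_def power_zero_numeral power_one, algebra+)
qed

lemma SE5_reducible_c: "SE5_reducible a b 0 g p q"
proof -
  define h where "h = [:
    - 2*a*b - a*q - 2*b^2 - b*g - b*q - 3*a - 7*b - g - 2*q - 6,
    - 2*a - 5*b - g - 2*q - 8, -2:]"
  show ?thesis
    unfolding SE5_eq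
    by (rule reducible_e5_op_gauss_factor[where h = h, OF e5_coeffs_SE5 SE5_f_def SE5_w_perm(1)])
      (simp_all only: SE5_u_def SE5_v_def poly_eval h_def power_zero_numeral power_one, algebra+)
qed

lemma SE5_reducible_a_half_g: "SE5_reducible a b c (- 2*a - 2) p q"
proof -
  define h where "h = [:
    - a*q - 2*b^2 - 2*b*c - b*q - a - 5*b - 2*c - 2*q - 4,
    - 5*b - 3*c - 2*q - 6, -2:]"
  show ?thesis
    unfolding SE5_eq
    by (rule reducible_e5_op_gauss_factor[where h = h, OF e5_coeffs_SE5 SE5_f_def SE5_w_perm(3)])
      (simp_all only: SE5_u_def SE5_v_def poly_eval h_def power_zero_numeral power_one, algebra+)
qed

lemma SE5_reducible_g: "SE5_reducible a b c 1 p q"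
proof -
  define h where "h = [:
    - 4*a*b - 2*a*q - 4*b^2 - 4*b*c - 2*b*q - 6*a - 16*b - 4*c - 4*q - 14,
    - 4*a - 6*b - 2*c - 2*q - 12, -2:]"
  show ?thesis
    unfolding SE5_eq
    by (rule reducible_e5_op_gauss_factor[where h = h, OF e5_coeffs_SE5 SE5_f_perm SE5_w_perm(2)])
      (simp_all only: SE5_u_def SE5_v_def poly_eval h_def power_zero_numeral power_one, algebra+)
qed

text \<open>The second alternative is \<open>r = 1\<close>, where \<theta>+s+1 becomes \<theta>. In
  the first, \<open>SE5_f\<close> acquires the factor \<theta>, and the constant term of
  \<open>SE5_u\<close> vanishes as well.\<close>

lemma SE5_reducible_D_factor:
  assumes "2*a + 2*b + g + 3 = 0 \<or> 2*a + 2*b + 2*c + g + p + q + 3 = -1"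
  shows "SE5_reducible a b c g p q"
proof -
  let ?s = "2*a + 2*b + 2*c + g + p + q + 3"
  show ?thesis
    using assms
  proof
    assume "2*a + 2*b + g + 3 = 0"
    then have g: "g = - 2*a - 2*b - 3" by algebra
    have "SE5_f a b g = [:0, 1:] * lin (a + b + 2)"
      unfolding SE5_f_def g by simp
    then have f: "lin (?s + 1) * lin (?s + 2) * lin (?s + 3) * SE5_f a b g
        = lin (?s + 1) * lin (?s + 2) * lin (?s + 3) * lin (a + b + 2) * [:0, 1:]"
      by (simp only: mult_ac)
    obtain k0 k where k: "SE5_u a b c g q = pCons k0 k" by (rule pCons_cases)
    have "poly (SE5_u a b c g q) 0 = 0"
      unfolding SE5_u_def g poly_eval by algebra
    with k have "SE5_u a b c g q = k * [:0, 1:]" by simp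
    then have u: "lin (?s + 1) * lin (?s + 2) * SE5_u a b c g q
        = lin (?s + 1) * lin (?s + 2) * k * [:0, 1:]"
      by (simp only: mult_ac)
    show ?thesis
      unfolding SE5_eq by (rule reducible_e5_op_D_factor[OF e5_coeffs_SE5 f u])
  next
    assume "?s = -1"
    then have s: "lin (?s + 1) = [:0, 1:]" by simp
    have "lin (?s + 1) * lin (?s + 2) * lin (?s + 3) * SE5_f a b g
        = lin (?s + 2) * lin (?s + 3) * SE5_f a b g * [:0, 1:]"
      and "lin (?s + 1) * lin (?s + 2) * SE5_u a b c g q = lin (?s + 2) * SE5_u a b c g q * [:0, 1:]"
      unfolding s by (simp_all only: mult_ac)
    then show ?thesis
      unfolding SE5_eq by (rule reducible_e5_op_D_factor[OF e5_coeffs_SE5])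
  qed
qed

text \<open>The factor \<theta>+3-e_i of \<open>T3\<close> equals \<theta>+s+3 exactly when e_i = r,
  because s = -r.\<close>

lemma SE5_reducible_theta_factor:
  assumes "p + 1 = 0 \<or> a + c + p + 2 = 0 \<or> 2*a + 2*c + p + g + 3 = 0"
  shows "SE5_reducible a b c g p q"
proof -
  let ?s = "2*a + 2*b + 2*c + g + p + q + 3"
  let ?e1 = "2*a + 2*b + 2*c + g + q + 5" and ?e2 = "a + 2*b + c + g + q + 4" and ?e3 = "2*b + q + 3"
  have "?s + 3 = ?e1 \<or> ?s + 3 = ?e2 \<or> ?s + 3 = ?e3"
    using assms by algebra
  moreover have "SE5_w a b c g q = lin ?e1 * - (lin ?e2 * lin ?e3)"
    "SE5_w a b c g q = lin ?e2 * - (lin ?e1 * lin ?e3)"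
    "SE5_w a b c g q = lin ?e3 * - (lin ?e1 * lin ?e2)"
    unfolding mult_minus_right by (rule SE5_w_perm)+
  moreover have "SE5_reducible a b c g p q" if "?s + 3 = k" "SE5_w a b c g q = lin k * h" for k h
    unfolding SE5_eq
    by (rule reducible_e5_op_theta_factor[OF e5_coeffs_SE5]) (simp only: that)
  ultimately show ?thesis by blast
qed

text \<open>The product is \<open>(e\<^sub>4 - r)(e\<^sub>5 - r)(e\<^sub>6 - r)\<close>.\<close>

lemma SE5_reducible_theta_minus_D_factor:
  assumes "(q + 1) * (b + c + q + 2) * (2*b + 2*c + q + g + 3) = 0"
  shows "SE5_reducible a b c g p q"
  unfolding SE5_eq
proof (rule reducible_e5_op_theta_minus_D_factor[OF e5_coeffs_SE5])
  fix t
  have "poly (SE5_u a b c g q) t + poly (SE5_v a b c g q) t + poly (SE5_w a b c g q) t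
      + t * poly (SE5_f a b g) (t - 1) = - ((q + 1) * (b + c + q + 2) * (2*b + 2*c + q + g + 3))"
    unfolding SE5_poly_defs poly_eval by algebra
  then show "poly (SE5_u a b c g q) t + poly (SE5_v a b c g q) t + poly (SE5_w a b c g q) t
      + t * poly (SE5_f a b g) (t - 1) = 0"
    by (simp only: assms neg_equal_0_iff_equal)
qed

section \<open>Integer shifts and reduction to the special values\<close>

lemma periodic_Ints:
  fixes P :: "complex \<Rightarrow> bool"
  assumes step: "\<And>z. P (z + 1) \<longleftrightarrow> P z" and "k \<in> \<int>"
  shows "P (z + k) \<longleftrightarrow> P z"
proof -
  have nat: "P (z + of_nat n) \<longleftrightarrow> P z" for n z
  proof (induction n)
    case (Suc n)
    then show ?case using step[of "z + of_nat n"] by (simp add: add_ac)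
  qed simp
  from \<open>k \<in> \<int>\<close> obtain n where "k = of_nat n \<or> k = - of_nat n"
    by (metis Ints_cases int_cases2 of_int_minus of_int_of_nat_eq)
  then show ?thesis using nat[of z n] nat[of "z - of_nat n" n] by auto
qed

lemma SE5_a_shift_Ints: "k \<in> \<int> \<Longrightarrow> SE5_reducible (a + k) b c g p q \<longleftrightarrow> SE5_reducible a b c g p q"
  by (rule periodic_Ints[where P = "\<lambda>a. SE5_reducible a b c g p q"]) (rule SE5_a_shift)

lemma SE5_p_shift_Ints: "k \<in> \<int> \<Longrightarrow> SE5_reducible a b c g (p + k) q \<longleftrightarrow> SE5_reducible a b c g p q"
  by (rule periodic_Ints[where P = "\<lambda>p. SE5_reducible a b c g p q"]) (rule SE5_p_shift)

lemma SE5_q_shift_Ints: "k \<in> \<int> \<Longrightarrow> SE5_reducible a b c g p (q + k) \<longleftrightarrow> SE5_reducible a b c g p q"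
  by (rule periodic_Ints[where P = "\<lambda>q. SE5_reducible a b c g p q"]) (rule SE5_q_shift)

lemma SE5_g_shift_Ints:
  assumes "k \<in> \<int>"
  shows "SE5_reducible a b (c - k) (g + 2*k) (p + k) (q + k) \<longleftrightarrow> SE5_reducible a b c g p q"
proof -
  have "SE5_reducible a b (c - (z + 1)) (g + 2*(z + 1)) (p + (z + 1)) (q + (z + 1))
      \<longleftrightarrow> SE5_reducible a b (c - z) (g + 2*z) (p + z) (q + z)" for z
    using SE5_g_shift[of a b "c - z" "g + 2*z" "p + z" "q + z"] by (simp add: algebra_simps)
  from periodic_Ints[where P = "\<lambda>z. SE5_reducible a b (c - z) (g + 2*z) (p + z) (q + z)"
      and z = 0, OF this assms]
  show ?thesis by simp
qed

text \<open>Moving \<open>b\<close> by \<open>k\<close> and \<open>c\<close> by \<open>-k\<close>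
  fixes \<open>d\<close>. After the symmetry, only the first parameter has changed, so this is the
  shift of \<open>a\<close> in disguise.\<close>

lemma SE5_c_shift_Ints:
  assumes "k \<in> \<int>"
  shows "SE5_reducible a (b + k) (c - k) g (p + 2*k) q \<longleftrightarrow> SE5_reducible a b c g p q"
proof -
  define d where "d = - (a + b + c + g + 2)"
  have d: "d = - (a + (b + k) + (c - k) + g + 2)" by (simp add: d_def)
  have p: "p + 2*k + 2*a + 2*(c - k) + g + 2 = p + 2*a + 2*c + g + 2"
    and q: "q + 2*(b + k) + 2*(c - k) + g + 2 = q + 2*b + 2*c + g + 2"
    by algebra+
  show ?thesis
    using SE5_sym[OF d_def, of p q] SE5_sym[OF d, of "p + 2*k" q] SE5_a_shift_Ints[OF assms]
    unfolding p q by metis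
qed

lemma SE5_reducible_a_Ints:
  assumes "a \<in> \<int> \<or> a + g/2 + 1 \<in> \<int> \<or> a + b + g/2 + 3/2 \<in> \<int>"
  shows "SE5_reducible a b c g p q"
proof -
  have "SE5_reducible (a + - a) b c g p q" by (simp add: SE5_reducible_a)
  moreover have "SE5_reducible (a + - (a + g/2 + 1)) b c g p q"
  proof -
    have "g = - 2*(a + - (a + g/2 + 1)) - 2" by algebra
    then show ?thesis by (metis SE5_reducible_a_half_g)
  qed
  moreover have "SE5_reducible (a + - (a + b + g/2 + 3/2)) b c g p q"
    by (intro SE5_reducible_D_factor disjI1) algebra
  ultimately show ?thesis
    using assms SE5_a_shift_Ints Ints_minus by metis
qed

lemma SE5_reducible_c_Ints:
  assumes "c \<in> \<int> \<or> c + g/2 + 1 \<in> \<int>"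
  shows "SE5_reducible a b c g p q"
proof -
  have "SE5_reducible a (b + c) (c - c) g (p + 2*c) q"
    by (simp add: SE5_reducible_c)
  moreover have "SE5_reducible a (b + k) (c - k) g (p + 2*k) q" if "k = c + g/2 + 1" for k
  proof -
    have "g = - 2*(c - k) - 2" unfolding that by algebra
    then show ?thesis by (metis SE5_reducible_c_half_g)
  qed
  ultimately show ?thesis
    using assms SE5_c_shift_Ints by metis
qed

text \<open>Stated polymorphically because arithmetic with division on type \<^typ>\<open>complex\<close> need not
  terminate in the presence of its Euclidean ring structure.\<close>

lemma neg_sum_plus_half:
  fixes g :: "'a :: field_char_0"
  shows "- (a + b + c + g + 2) + g/2 + 1 = - (a + b + c + g/2 + 1)"
  by (simp add: field_simps)

lemma plus_double_half_diff:
  fixes g :: "'a :: field_char_0"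
  shows "g + 2 * (1/2 - g/2) = 1"
  by (simp add: field_simps)

theorem theorem8p5:
  fixes a b c g p q \<delta> r :: complex and e :: "nat \<Rightarrow> complex"
  assumes "\<delta> = a + b + c"
    and "e = SE5_exps a b c g p q"
    and "r = SE5_r a b c g p q"
    and "\<exists>v \<in> {- a, - b, - c, 1/2 - g/2, a + g/2 + 1, b + g/2 + 1, c + g/2 + 1,
          \<delta> + g + 2, - (\<delta> + g/2 + 1), a + b + g/2 + 3/2}
        \<union> {e i - r |i. 1 \<le> i \<and> i \<le> 6} \<union> {r}. v \<in> \<int>"
  shows "reducible_op (SE5 a b c g p q)"
proof -
  define d where "d = - (a + b + c + g + 2)"
  \<comment> \<open>The symmetry reduces the conditions on \<open>b\<close> to those on
    \<open>a\<close>, and the two conditions on \<delta> to those on \<open>c\<close>, with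
    \<open>d\<close> in place of \<open>c\<close>.\<close>
  note sym = SE5_sym[OF d_def, of p q, symmetric]
  have "{e i - r |i. 1 \<le> i \<and> i \<le> 6} = (\<lambda>i. e i - r) ` {1..6}"
    by auto
  also have "{1..6::nat} = {1, 2, 3, 4, 5, 6}"
    by auto
  finally have e: "{e i - r |i. 1 \<le> i \<and> i \<le> 6} = {p + 1, a + c + p + 2, 2*a + 2*c + p + g + 3,
      q + 1, b + c + q + 2, 2*b + 2*c + q + g + 3}"
    by (simp only: assms(2,3) SE5_exps_minus_r image_insert image_empty)
  obtain v where v: "v \<in> \<int>" and
    "v \<in> {- a, - b, - c, 1/2 - g/2, a + g/2 + 1, b + g/2 + 1, c + g/2 + 1,
          \<delta> + g + 2, - (\<delta> + g/2 + 1), a + b + g/2 + 3/2}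
        \<union> {p + 1, a + c + p + 2, 2*a + 2*c + p + g + 3,
          q + 1, b + c + q + 2, 2*b + 2*c + q + g + 3} \<union> {r}"
    using assms(4) unfolding e by blast
  then consider
      "v \<in> {- a, a + g/2 + 1, a + b + g/2 + 3/2}" | "v \<in> {- b, b + g/2 + 1}"
    | "v \<in> {- c, c + g/2 + 1}" | "v \<in> {\<delta> + g + 2, - (\<delta> + g/2 + 1)}" | "v = 1/2 - g/2"
    | "v \<in> {p + 1, a + c + p + 2, 2*a + 2*c + p + g + 3}"
    | "v \<in> {q + 1, b + c + q + 2, 2*b + 2*c + q + g + 3}" | "v = r"
    by (simp only: Un_iff insert_iff empty_iff) metis
  then show ?thesis
  proof cases
    case 1
    then show ?thesis using v by (intro SE5_reducible_a_Ints) auto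
  next
    case 2
    then show ?thesis using v unfolding sym by (intro SE5_reducible_a_Ints) auto
  next
    case 3
    then show ?thesis using v by (intro SE5_reducible_c_Ints) auto
  next
    case 4
    have "d = - (\<delta> + g + 2)"
      by (simp only: d_def assms(1))
    moreover have "d + g/2 + 1 = - (\<delta> + g/2 + 1)"
      unfolding d_def assms(1) by (rule neg_sum_plus_half)
    moreover have "\<delta> + g + 2 \<in> \<int> \<or> - (\<delta> + g/2 + 1) \<in> \<int>"
      using 4 v by blast
    ultimately have "d \<in> \<int> \<or> d + g/2 + 1 \<in> \<int>"
      using Ints_minus by metis
    then show ?thesis
      unfolding sym by (rule SE5_reducible_c_Ints)
  next
    case 5
    have "g + 2*v = 1" unfolding 5 by (rule plus_double_half_diff)
    then show ?thesis
      using SE5_g_shift_Ints[OF v, of a b c g p q] SE5_reducible_g by metis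
  next
    case 6
    then have "v = p + 1 \<or> v = a + c + p + 2 \<or> v = 2*a + 2*c + p + g + 3"
      by (simp only: insert_iff empty_iff simp_thms)
    \<comment> \<open>Each e_i - r with i \<le> 3 contains \<open>p\<close> with coefficient 1, so
      subtracting \<open>v\<close> makes the one in question zero.\<close>
    then have "SE5_reducible a b c g (p + - v) q"
      by (intro SE5_reducible_theta_factor) algebra
    then show ?thesis using v by (simp only: SE5_p_shift_Ints Ints_minus)
  next
    case 7
    then have "v = q + 1 \<or> v = b + c + q + 2 \<or> v = 2*b + 2*c + q + g + 3"
      by (simp only: insert_iff empty_iff simp_thms)
    then have "SE5_reducible a b c g p (q + - v)"
      by (intro SE5_reducible_theta_minus_D_factor) algebra
    then show ?thesis using v by (simp only: SE5_q_shift_Ints Ints_minus)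
  next
    case 8
    \<comment> \<open>The shift is by \<open>v - 1\<close> because the explicit factor \<partial>
      occurs at \<open>r = 1\<close>, and \<open>r\<close> decreases as \<open>p\<close>
      grows.\<close>
    then have "SE5_reducible a b c g (p + (v - 1)) q"
      unfolding assms(3) SE5_r_def by (intro SE5_reducible_D_factor disjI2) algebra
    then show ?thesis using v by (simp only: SE5_p_shift_Ints Ints_diff Ints_1)
  qed
qed

end
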